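(* Let $X$ be a separable metric space. Then for every $p$ with $1\le p<2$ the following conditions are equivalent: (1) $X$ admits a coarse embedding into the Hilbert space $\ell_2$; (2) $X$ admits a coarse embedding into $\ell_p$; (3) $X$ admits a coarse embedding into $L_p[0,1]$.
   Context: For $1\le p<\infty$, $\ell_p=\ell_p(\mathbb{N})$ is the Banach space of real $p$-summable sequences with norm $\|x\|_p=\left(\sum_i |x_i|^p\right)^{1/p}$, and $L_p[0,1]$ is the usual Lebesgue space of (classes of) real $p$-integrable functions on $[0,1]$ with Lebesgue measure; both are regarded as metric spaces with the norm metric. Let $X,Y$ be metric spaces. A map $f\colon X\to Y$ (not necessarily continuous) is a coarse embedding if there exist non-decreasing functions $\rho_1,\rho_2\colon[0,\infty)\to[0,\infty)$ such that (1) $\rho_1(d_X(x,y))\le d_Y(f(x),f(y))\le\rho_2(d_X(x,y))$ for all $x,y\in X$, and (2) $\lim_{t\to\infty}\rho_1(t)=+\infty$. The space $X$ admits a coarse embedding into $Y$ if such a map $f$ exists. *)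

theory Defs
  imports "HOL-Analysis.Analysis"
begin

definition coarse_embedding ::
  "'a set \<Rightarrow> ('a \<Rightarrow> 'a \<Rightarrow> real) \<Rightarrow> 'b set \<Rightarrow> ('b \<Rightarrow> 'b \<Rightarrow> real) \<Rightarrow> ('a \<Rightarrow> 'b) \<Rightarrow> bool"
where
  "coarse_embedding M d N e f \<longleftrightarrow>
     f ` M \<subseteq> N \<and>
     (\<exists>\<rho>1 \<rho>2 :: real \<Rightarrow> real.
        mono_on {0..} \<rho>1 \<and> \<rho>1 ` {0..} \<subseteq> {0..} \<and>
        mono_on {0..} \<rho>2 \<and> \<rho>2 ` {0..} \<subseteq> {0..} \<and>
        (\<forall>x\<in>M. \<forall>y\<in>M. \<rho>1 (d x y) \<le> e (f x) (f y) \<and> e (f x) (f y) \<le> \<rho>2 (d x y)) \<and>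
        filterlim \<rho>1 at_top at_top)"

definition coarsely_embeds ::
  "'a set \<Rightarrow> ('a \<Rightarrow> 'a \<Rightarrow> real) \<Rightarrow> 'b set \<Rightarrow> ('b \<Rightarrow> 'b \<Rightarrow> real) \<Rightarrow> bool"
where
  "coarsely_embeds M d N e \<longleftrightarrow> (\<exists>f. coarse_embedding M d N e f)"

definition ell :: "real \<Rightarrow> (nat \<Rightarrow> real) set" where
  "ell p = {x. summable (\<lambda>i. \<bar>x i\<bar> powr p)}"

definition ell_norm :: "real \<Rightarrow> (nat \<Rightarrow> real) \<Rightarrow> real" where
  "ell_norm p x = (\<Sum>i. \<bar>x i\<bar> powr p) powr (1 / p)"

definition ell_dist :: "real \<Rightarrow> (nat \<Rightarrow> real) \<Rightarrow> (nat \<Rightarrow> real) \<Rightarrow> real" where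
  "ell_dist p x y = ell_norm p (\<lambda>i. x i - y i)"

text \<open>Functions are total on the reals, but only their restrictions to [0,1] matter:
  measurability, integrability and almost-everywhere equality all refer to Lebesgue
  measure on [0,1], so the classes below are exactly the elements of the Lebesgue space.\<close>

definition Lp_fun :: "real \<Rightarrow> (real \<Rightarrow> real) set" where
  "Lp_fun p = {f \<in> borel_measurable (lebesgue_on {0..1}).
                 integrable (lebesgue_on {0..1}) (\<lambda>t. \<bar>f t\<bar> powr p)}"

definition Lp_rel :: "real \<Rightarrow> ((real \<Rightarrow> real) \<times> (real \<Rightarrow> real)) set" where
  "Lp_rel p = {(f, g). f \<in> Lp_fun p \<and> g \<in> Lp_fun p \<and>
                 (AE t in lebesgue_on {0..1}. f t = g t)}"

definition Lp :: "real \<Rightarrow> (real \<Rightarrow> real) set set" where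
  "Lp p = Lp_fun p // Lp_rel p"

definition Lp_seminorm :: "real \<Rightarrow> (real \<Rightarrow> real) \<Rightarrow> real" where
  "Lp_seminorm p f = (LINT t|lebesgue_on {0..1}. \<bar>f t\<bar> powr p) powr (1 / p)"

text \<open>The choice of representatives is immaterial; see \<open>Lp_dist_class\<close> below.\<close>

definition Lp_dist :: "real \<Rightarrow> (real \<Rightarrow> real) set \<Rightarrow> (real \<Rightarrow> real) set \<Rightarrow> real" where
  "Lp_dist p A B = Lp_seminorm p (\<lambda>t. (SOME f. f \<in> A) t - (SOME g. g \<in> B) t)"

lemma equiv_Lp_rel: "equiv (Lp_fun p) (Lp_rel p)"
proof (rule equivI)
  show "refl_on (Lp_fun p) (Lp_rel p)"
    by (auto simp: refl_on_def Lp_rel_def)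
  show "sym (Lp_rel p)"
    by (auto simp: sym_def Lp_rel_def elim: eventually_mono)
  show "trans (Lp_rel p)"
    by (auto simp: trans_def Lp_rel_def elim: eventually_elim2)
qed (auto simp: Lp_rel_def)

lemma Lp_dist_class:
  assumes "f \<in> Lp_fun p" "g \<in> Lp_fun p"
  shows "Lp_dist p (Lp_rel p `` {f}) (Lp_rel p `` {g}) = Lp_seminorm p (\<lambda>t. f t - g t)"
proof -
  define f' where "f' = (SOME h. h \<in> Lp_rel p `` {f})"
  define g' where "g' = (SOME h. h \<in> Lp_rel p `` {g})"
  have "f \<in> Lp_rel p `` {f}" "g \<in> Lp_rel p `` {g}"
    using assms by (auto simp: Lp_rel_def)
  then have "f' \<in> Lp_rel p `` {f}" "g' \<in> Lp_rel p `` {g}"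
    unfolding f'_def g'_def by (metis someI_ex)+
  then have f': "f' \<in> Lp_fun p" "AE t in lebesgue_on {0..1}. f t = f' t"
    and g': "g' \<in> Lp_fun p" "AE t in lebesgue_on {0..1}. g t = g' t"
    by (auto simp: Lp_rel_def)
  have m: "f \<in> borel_measurable (lebesgue_on {0..1})" "g \<in> borel_measurable (lebesgue_on {0..1})"
    "f' \<in> borel_measurable (lebesgue_on {0..1})" "g' \<in> borel_measurable (lebesgue_on {0..1})"
    using assms f' g' by (auto simp: Lp_fun_def)
  have "(LINT t|lebesgue_on {0..1}. \<bar>f' t - g' t\<bar> powr p) =
        (LINT t|lebesgue_on {0..1}. \<bar>f t - g t\<bar> powr p)"
  proof (rule integral_cong_AE)
    show "AE t in lebesgue_on {0..1}. \<bar>f' t - g' t\<bar> powr p = \<bar>f t - g t\<bar> powr p"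
      using f'(2) g'(2) by eventually_elim simp
  qed (use m in measurable)
  then show ?thesis
    unfolding Lp_dist_def Lp_seminorm_def f'_def g'_def by (rule arg_cong)
qed

end

theory Submission
  imports Defs "HOL-Real_Asymp.Real_Asymp"
begin

text \<open>The link between the three targets is the notion of a kernel of negative type: a symmetric kernel \<open>N\<close>,
  zero on the diagonal, whose quadratic form is nonpositive on coefficient vectors with sum 0.
  By Schoenberg these are exactly the squares of Hilbert space distances. As the space is separable,
  it is enough to work with kernels on the integers, given by the distances between the images of a
  dense sequence (\<open>coarsely_embeds_transfer\<close>).

  From \<open>L\<^sub>p\<close> to \<open>\<ell>\<^sub>2\<close>: for \<open>p < 2\<close> the kernel \<open>\<bar>a - b\<bar> powr p\<close> on the real line has negative type, as a
  fractional power of the squared distance (\<open>negative_type_powr\<close>). Integration shows that the \<open>p\<close>-th power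
  of the \<open>L\<^sub>p\<close> distance has negative type (\<open>negative_type_Lp\<close>), so its square root is realized as a distance in
  \<open>\<ell>\<^sub>2\<close> (\<open>negative_type_isometric_ell2\<close>). A positive power of a distance is controlled by the distance and
  controls it.

  From \<open>\<ell>\<^sub>2\<close> to \<open>\<ell>\<^sub>p\<close>: the squared distance \<open>N\<close> of \<open>\<ell>\<^sub>2\<close> has negative type, so for \<open>t > 0\<close> the Gaussian kernel
  \<open>exp (- t * N)\<close> has positive type and is the Gram kernel of a sequence of unit vectors. The Mazur map
  carries the unit sphere of \<open>\<ell>\<^sub>2\<close> to that of \<open>\<ell>\<^sub>p\<close> with uniformly continuous inverse, so for each
  scale \<open>t\<close> there is a map into the sphere of \<open>\<ell>\<^sub>p\<close> that sends pairs of points with small \<open>N\<close> close together and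
  separates pairs with \<open>N\<close> above \<open>1 / t\<close> (\<open>gaussian_sphere_map\<close>). The \<open>\<ell>\<^sub>p\<close> sum of these maps over geometrically
  decreasing scales is the required embedding (\<open>negative_type_coarse_ell_p\<close>).

  From \<open>\<ell>\<^sub>p\<close> to \<open>L\<^sub>p\<close>: sequences become step functions on a countable partition of the unit interval, which is
  an isometry (\<open>ell_p_isometric_Lp\<close>).

  All realizations in sequence spaces rest on an infinite Cholesky factorization of positive type
  kernels (\<open>positive_type_gram\<close>).\<close>

section \<open>Kernels of positive and negative type\<close>

definition quad_form :: "'i set \<Rightarrow> ('i \<Rightarrow> real) \<Rightarrow> ('i \<Rightarrow> 'i \<Rightarrow> real) \<Rightarrow> real" where
  "quad_form A c K = (\<Sum>i\<in>A. \<Sum>j\<in>A. c i * c j * K i j)"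

definition positive_type :: "('i \<Rightarrow> 'i \<Rightarrow> real) \<Rightarrow> bool" where
  "positive_type K \<longleftrightarrow> (\<forall>i j. K i j = K j i) \<and> (\<forall>A c. finite A \<longrightarrow> 0 \<le> quad_form A c K)"

definition negative_type :: "('i \<Rightarrow> 'i \<Rightarrow> real) \<Rightarrow> bool" where
  "negative_type N \<longleftrightarrow> (\<forall>i. N i i = 0) \<and> (\<forall>i j. N i j = N j i) \<and>
     (\<forall>A c. finite A \<longrightarrow> sum c A = 0 \<longrightarrow> quad_form A c N \<le> 0)"

lemma quad_form_add:
  "quad_form A c (\<lambda>i j. K i j + L i j) = quad_form A c K + quad_form A c L"
  by (simp add: quad_form_def algebra_simps sum.distrib)

lemma quad_form_diff:
  "quad_form A c (\<lambda>i j. K i j - L i j) = quad_form A c K - quad_form A c L"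
  by (simp add: quad_form_def algebra_simps sum_subtractf)

lemma quad_form_scale: "quad_form A c (\<lambda>i j. r * K i j) = r * quad_form A c K"
  by (simp add: quad_form_def sum_distrib_left mult_ac)

lemma quad_form_product: "quad_form A c (\<lambda>i j. g i * h j) = (\<Sum>i\<in>A. c i * g i) * (\<Sum>i\<in>A. c i * h i)"
  by (simp add: quad_form_def sum_product mult_ac)

lemma quad_form_conjugate:
  "quad_form A c (\<lambda>i j. g i * g j * K i j) = quad_form A (\<lambda>i. c i * g i) K"
  by (simp add: quad_form_def mult_ac)

lemma quad_form_sum:
  "quad_form A c (\<lambda>i j. \<Sum>n\<in>B. K n i j) = (\<Sum>n\<in>B. quad_form A c (K n))"
proof -
  have "quad_form A c (\<lambda>i j. \<Sum>n\<in>B. K n i j) = (\<Sum>i\<in>A. \<Sum>j\<in>A. \<Sum>n\<in>B. c i * c j * K n i j)"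
    by (simp add: quad_form_def sum_distrib_left)
  also have "\<dots> = (\<Sum>i\<in>A. \<Sum>n\<in>B. \<Sum>j\<in>A. c i * c j * K n i j)"
    by (intro sum.cong refl sum.swap)
  also have "\<dots> = (\<Sum>n\<in>B. quad_form A c (K n))"
    unfolding quad_form_def by (rule sum.swap)
  finally show ?thesis .
qed

lemma quad_form_sums:
  assumes "\<And>i j. i \<in> A \<Longrightarrow> j \<in> A \<Longrightarrow> (\<lambda>n. K n i j) sums L i j"
  shows "(\<lambda>n. quad_form A c (K n)) sums quad_form A c L"
  unfolding quad_form_def by (intro sums_sum sums_mult assms)

lemma quad_form_tendsto:
  assumes "\<And>i j. i \<in> A \<Longrightarrow> j \<in> A \<Longrightarrow> ((\<lambda>n. K n i j) \<longlongrightarrow> L i j) F"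
  shows "((\<lambda>n. quad_form A c (K n)) \<longlongrightarrow> quad_form A c L) F"
  unfolding quad_form_def by (intro tendsto_intros assms)

text \<open>The coefficient vector on \<open>insert b A\<close> that extends \<open>c\<close> by zero and then receives the extra mass
  \<open>s\<close> at \<open>b\<close>. The point \<open>b\<close> may lie in \<open>A\<close> or outside it; both cases are handled by one formula.\<close>
definition add_weight :: "'i set \<Rightarrow> ('i \<Rightarrow> real) \<Rightarrow> 'i \<Rightarrow> real \<Rightarrow> 'i \<Rightarrow> real" where
  "add_weight A c b s i = (if i \<in> A then c i else 0) + (if i = b then s else 0)"

lemma sum_add_weight:
  assumes "finite A"
  shows "(\<Sum>i\<in>insert b A. add_weight A c b s i * g i) = (\<Sum>i\<in>A. c i * g i) + s * g b"
proof -
  have "(\<Sum>i\<in>insert b A. add_weight A c b s i * g i) =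
    (\<Sum>i\<in>insert b A. (if i \<in> A then c i else 0) * g i) + (\<Sum>i\<in>insert b A. (if i = b then s else 0) * g i)"
    by (simp only: add_weight_def distrib_right sum.distrib)
  also have "(\<Sum>i\<in>insert b A. (if i \<in> A then c i else 0) * g i) = (\<Sum>i\<in>A. c i * g i)"
    by (rule sum.mono_neutral_cong_right) (use assms in auto)
  also have "(\<Sum>i\<in>insert b A. (if i = b then s else 0) * g i) = (\<Sum>i\<in>insert b A. if i = b then s * g i else 0)"
    by (rule sum.cong) auto
  also have "\<dots> = s * g b"
    using assms by simp
  finally show ?thesis .
qed

text \<open>Polarization: the two arguments that compare a coefficient vector with a point mass, the
  Cauchy-Schwarz inequality and the passage from negative to positive type, both read off the
  resulting quadratic polynomial in \<open>s\<close>.\<close>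
lemma quad_form_add_weight:
  assumes "finite A" and sym: "\<And>i j. K i j = K j i"
  shows "quad_form (insert b A) (add_weight A c b s) K =
         quad_form A c K + 2 * s * (\<Sum>i\<in>A. c i * K i b) + s\<^sup>2 * K b b"
proof -
  have "quad_form (insert b A) (add_weight A c b s) K =
    (\<Sum>i\<in>insert b A. add_weight A c b s i * (\<Sum>j\<in>insert b A. add_weight A c b s j * K i j))"
    by (simp only: quad_form_def sum_distrib_left mult_ac)
  also have "\<dots> = (\<Sum>i\<in>A. c i * ((\<Sum>j\<in>A. c j * K i j) + s * K i b)) +
      s * ((\<Sum>j\<in>A. c j * K b j) + s * K b b)"
    by (simp only: sum_add_weight[OF assms(1)])
  also have "(\<Sum>j\<in>A. c j * K b j) = (\<Sum>j\<in>A. c j * K j b)"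
    by (intro sum.cong refl) (metis sym)
  also have "(\<Sum>i\<in>A. c i * ((\<Sum>j\<in>A. c j * K i j) + s * K i b)) =
      quad_form A c K + s * (\<Sum>i\<in>A. c i * K i b)"
    by (simp add: quad_form_def distrib_left sum.distrib sum_distrib_left mult_ac)
  also have "quad_form A c K + s * (\<Sum>i\<in>A. c i * K i b) + s * ((\<Sum>j\<in>A. c j * K j b) + s * K b b) =
      quad_form A c K + 2 * s * (\<Sum>i\<in>A. c i * K i b) + s\<^sup>2 * K b b"
    by (simp add: algebra_simps power2_eq_square)
  finally show ?thesis .
qed

lemma discriminant_le:
  fixes q b k :: real
  assumes "\<And>s. 0 \<le> q + 2 * s * b + s\<^sup>2 * k" and k: "0 \<le> k"
  shows "b\<^sup>2 \<le> q * k"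
proof (cases "k = 0")
  case True
  have "b = 0"
  proof (rule ccontr)
    assume "b \<noteq> 0"
    then show False
      using assms(1)[of "- (q + 1) / (2 * b)"] True by (simp add: field_simps)
  qed
  then show ?thesis using True by simp
next
  case False
  then have "0 \<le> (q - b\<^sup>2 / k)"
    using assms(1)[of "- b / k"] by (simp add: field_simps power2_eq_square)
  then show ?thesis using False k by (simp add: field_simps)
qed

lemma positive_type_sym: "positive_type K \<Longrightarrow> K i j = K j i"
  by (auto simp: positive_type_def)

lemma positive_type_diag:
  assumes "positive_type K" shows "0 \<le> K i i"
proof -
  have "0 \<le> quad_form {i} (\<lambda>_. 1) K"
    using assms unfolding positive_type_def by blast
  then show ?thesis by (simp add: quad_form_def)
qed

lemma positive_type_cauchy_schwarz:
  assumes K: "positive_type K" and A: "finite A"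
  shows "(\<Sum>i\<in>A. c i * K i b)\<^sup>2 \<le> quad_form A c K * K b b"
proof (rule discriminant_le)
  fix s
  have "0 \<le> quad_form (insert b A) (add_weight A c b s) K"
    using K A by (auto simp: positive_type_def)
  then show "0 \<le> quad_form A c K + 2 * s * (\<Sum>i\<in>A. c i * K i b) + s\<^sup>2 * K b b"
    by (simp add: quad_form_add_weight[OF A positive_type_sym[OF K]])
qed (rule positive_type_diag[OF K])

lemma positive_type_zero_diag:
  assumes K: "positive_type K" and "K b b = 0"
  shows "K i b = 0"
  using positive_type_cauchy_schwarz[OF K, of "{i}" "\<lambda>_. 1" b] assms(2) by simp

text \<open>One step of Gaussian elimination stays within positive type: the form of the new kernel is the old
  form minus \<open>B\<^sup>2 / K b b\<close> with \<open>B = (\<Sum>i\<in>A. c i * K i b)\<close>, and Cauchy-Schwarz bounds the subtracted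
  term. If the pivot \<open>K b b\<close> vanishes, division by zero makes the step trivial, as it should be:
  then the whole column of \<open>b\<close> vanishes.\<close>
lemma positive_type_schur_complement:
  assumes K: "positive_type K"
  shows "positive_type (\<lambda>i j. K i j - K i b * K j b / K b b)"
  unfolding positive_type_def
proof (intro conjI allI impI)
  show "K i j - K i b * K j b / K b b = K j i - K j b * K i b / K b b" for i j
    by (simp add: positive_type_sym[OF K, of i j])
next
  fix A :: "'a set" and c :: "'a \<Rightarrow> real" assume A: "finite A"
  let ?B = "\<Sum>i\<in>A. c i * K i b"
  have "quad_form A c (\<lambda>i j. K i j - K i b * K j b / K b b) = quad_form A c K - ?B * ?B / K b b"
    using quad_form_scale[of A c "1 / K b b" "\<lambda>i j. K i b * K j b"]
    by (simp add: quad_form_diff quad_form_product)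
  moreover have "?B * ?B / K b b \<le> quad_form A c K"
  proof (cases "K b b = 0")
    case True
    then show ?thesis using K A by (simp add: positive_type_def)
  next
    case False
    then show ?thesis
      using positive_type_cauchy_schwarz[OF K A, of c b] positive_type_diag[OF K, of b]
      by (simp add: divide_le_eq power2_eq_square)
  qed
  ultimately show "0 \<le> quad_form A c (\<lambda>i j. K i j - K i b * K j b / K b b)" by simp
qed

section \<open>Factorization of positive type kernels on the integers\<close>
fun eliminate :: "(nat \<Rightarrow> nat \<Rightarrow> real) \<Rightarrow> nat \<Rightarrow> nat \<Rightarrow> nat \<Rightarrow> real" where
  "eliminate K 0 i j = K i j"
| "eliminate K (Suc n) i j =
     eliminate K n i j - eliminate K n i n * eliminate K n j n / eliminate K n n n"

lemma positive_type_eliminate: "positive_type K \<Longrightarrow> positive_type (eliminate K n)"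
proof (induction n)
  case 0
  moreover have "eliminate K 0 = K" by (intro ext) simp
  ultimately show ?case by simp
next
  case (Suc n)
  have "eliminate K (Suc n) = (\<lambda>i j.
      eliminate K n i j - eliminate K n i n * eliminate K n j n / eliminate K n n n)"
    by (intro ext) simp
  then show ?case using positive_type_schur_complement[OF Suc.IH, of n] Suc.prems by simp
qed

text \<open>Once an index has served as pivot, its row is zero for good. This is why only finitely many columns
  contribute to each entry of the factorization below.\<close>
lemma eliminate_eq_0:
  assumes "positive_type K" "i < n" shows "eliminate K n i j = 0"
  using assms(2)
proof (induction n arbitrary: j)
  case (Suc n)
  let ?S = "eliminate K n"
  note S = positive_type_eliminate[OF assms(1), of n]
  show ?case
  proof (cases "i = n")
    case True
    then show ?thesis
      using positive_type_zero_diag[OF S, of n j] by (cases "?S n n = 0") (auto simp: positive_type_sym[OF S, of n j])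
  next
    case False
    then show ?thesis
      using Suc by simp
  qed
qed simp

text \<open>The infinite Cholesky factorization. Collecting the rank one terms removed by the successive
  eliminations writes \<open>K\<close> as a Gram matrix of vectors which are finitely supported, so that
  inner products are finite sums. It is the device that lands abstract Hilbert space constructions in sequence spaces.\<close>
lemma positive_type_gram:
  assumes K: "positive_type (K :: nat \<Rightarrow> nat \<Rightarrow> real)"
  obtains \<phi> :: "nat \<Rightarrow> nat \<Rightarrow> real"
  where "\<And>i n. i < n \<Longrightarrow> \<phi> i n = 0" and "\<And>i j m. i < m \<Longrightarrow> K i j = (\<Sum>n<m. \<phi> i n * \<phi> j n)"
proof
  define \<phi> where "\<phi> i n = eliminate K n i n / sqrt (eliminate K n n n)" for i n
  show "\<phi> i n = 0" if "i < n" for i n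
    using eliminate_eq_0[OF K that] by (simp add: \<phi>_def)
  have step: "K i j = eliminate K m i j + (\<Sum>n<m. \<phi> i n * \<phi> j n)" for i j m
  proof (induction m)
    case (Suc m)
    then show ?case
      using positive_type_diag[OF positive_type_eliminate[OF K, of m], of m]
      by (simp add: \<phi>_def real_sqrt_mult_self)
  qed simp
  show "K i j = (\<Sum>n<m. \<phi> i n * \<phi> j n)" if "i < m" for i j m
    using step[of i j m] eliminate_eq_0[OF K that, of j] by simp
qed

text \<open>Schur's product theorem: replacing \<open>K\<close> by its Gram factorization turns the form of the product into a
  sum of forms of \<open>L\<close> with rescaled coefficients.\<close>
lemma positive_type_mult:
  assumes K: "positive_type (K :: nat \<Rightarrow> nat \<Rightarrow> real)" and L: "positive_type L"
  shows "positive_type (\<lambda>i j. K i j * L i j)"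
  unfolding positive_type_def
proof (intro conjI allI impI)
  show "K i j * L i j = K j i * L j i" for i j
    by (simp add: positive_type_sym[OF K, of i j] positive_type_sym[OF L, of i j])
  fix A :: "nat set" and c :: "nat \<Rightarrow> real" assume A: "finite A"
  obtain \<phi> where \<phi>: "\<And>i j m. i < m \<Longrightarrow> K i j = (\<Sum>n<m. \<phi> i n * \<phi> j n)"
    using positive_type_gram[OF K] by metis
  obtain m where m: "\<forall>i\<in>A. i < m"
    using A finite_nat_set_iff_bounded by blast
  have "quad_form A c (\<lambda>i j. K i j * L i j) = quad_form A c (\<lambda>i j. \<Sum>n<m. \<phi> i n * \<phi> j n * L i j)"
    unfolding quad_form_def
    by (intro sum.cong refl) (use m in \<open>simp add: \<phi>[of _ m] sum_distrib_right\<close>)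
  also have "\<dots> = (\<Sum>n<m. quad_form A (\<lambda>i. c i * \<phi> i n) L)"
    by (simp only: quad_form_sum quad_form_conjugate)
  also have "\<dots> \<ge> 0"
    using L A by (intro sum_nonneg) (simp add: positive_type_def)
  finally show "0 \<le> quad_form A c (\<lambda>i j. K i j * L i j)" .
qed

lemma positive_type_power:
  assumes K: "positive_type (K :: nat \<Rightarrow> nat \<Rightarrow> real)"
  shows "positive_type (\<lambda>i j. K i j ^ n)"
proof (induction n)
  case 0
  have "quad_form A c (\<lambda>i j. 1) = (sum c A)\<^sup>2" for A :: "nat set" and c
    using quad_form_product[of A c "\<lambda>_. 1" "\<lambda>_. 1"] by (simp add: power2_eq_square)
  then show ?case by (simp add: positive_type_def)
next
  case (Suc n)
  then show ?case using positive_type_mult[OF K Suc.IH] by simp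
qed

lemma positive_type_exp:
  assumes K: "positive_type (K :: nat \<Rightarrow> nat \<Rightarrow> real)"
  shows "positive_type (\<lambda>i j. exp (K i j))"
  unfolding positive_type_def
proof (intro conjI allI impI)
  show "exp (K i j) = exp (K j i)" for i j
    by (simp add: positive_type_sym[OF K, of i j])
  fix A :: "nat set" and c :: "nat \<Rightarrow> real" assume A: "finite A"
  have sums: "(\<lambda>n. quad_form A c (\<lambda>i j. inverse (fact n) * K i j ^ n)) sums quad_form A c (\<lambda>i j. exp (K i j))"
    using exp_converges[where 'a = real] by (intro quad_form_sums) simp
  have "0 \<le> quad_form A c (\<lambda>i j. inverse (fact n) * K i j ^ n)" for n
    using positive_type_power[OF K, of n] A by (simp add: quad_form_scale positive_type_def)
  then show "0 \<le> quad_form A c (\<lambda>i j. exp (K i j))"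
    using sums_le[OF _ sums_zero sums] by blast
qed

section \<open>Schoenberg's theorems\<close>
lemma negative_type_diag: "negative_type N \<Longrightarrow> N i i = 0"
  by (simp add: negative_type_def)

lemma negative_type_sym: "negative_type N \<Longrightarrow> N i j = N j i"
  by (auto simp: negative_type_def)

lemma negative_type_nonneg:
  assumes N: "negative_type N" shows "0 \<le> N i j"
proof (cases "i = j")
  case False
  define c :: "'a \<Rightarrow> real" where "c l = (if l = i then 1 else - 1)" for l
  have "sum c {i, j} = 0" using False by (simp add: c_def)
  then have "quad_form {i, j} c N \<le> 0"
    using N unfolding negative_type_def by blast
  then show ?thesis
    using False negative_type_sym[OF N, of i j] by (simp add: quad_form_def c_def negative_type_diag[OF N])
qed (simp add: negative_type_diag[OF N])

text \<open>If \<open>N\<close> is a squared Hilbert distance, this kernel is twice the inner product with origin at \<open>b\<close>. In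
  general, moving the total mass \<open>sum c A\<close> to the base point \<open>b\<close> makes a coefficient vector balanced,
  and negative type applies.\<close>
lemma positive_type_of_negative_type:
  assumes N: "negative_type N"
  shows "positive_type (\<lambda>i j. N i b + N j b - N i j)"
  unfolding positive_type_def
proof (intro conjI allI impI)
  show "N i b + N j b - N i j = N j b + N i b - N j i" for i j
    by (simp add: negative_type_sym[OF N, of i j])
  fix A :: "'a set" and c :: "'a \<Rightarrow> real" assume A: "finite A"
  let ?s = "sum c A"
  have "(\<Sum>i\<in>insert b A. add_weight A c b (- ?s) i) = 0"
    using sum_add_weight[OF A, where g = "\<lambda>_. 1"] by simp
  then have "quad_form (insert b A) (add_weight A c b (- ?s)) N \<le> 0"
    using N A by (simp add: negative_type_def)
  then have "quad_form A c N - 2 * ?s * (\<Sum>i\<in>A. c i * N i b) \<le> 0"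
    by (simp add: quad_form_add_weight[OF A negative_type_sym[OF N]] negative_type_diag[OF N])
  moreover have "quad_form A c (\<lambda>i j. N i b + N j b - N i j) = 2 * ?s * (\<Sum>i\<in>A. c i * N i b) - quad_form A c N"
    using quad_form_product[of A c "\<lambda>i. N i b" "\<lambda>_. 1"] quad_form_product[of A c "\<lambda>_. 1" "\<lambda>i. N i b"]
    by (simp add: quad_form_add quad_form_diff)
  ultimately show "0 \<le> quad_form A c (\<lambda>i j. N i b + N j b - N i j)" by simp
qed

text \<open>Up to the rank one factor \<open>g i * g j\<close>, the Gaussian kernel is the exponential of a positive type kernel.\<close>
lemma positive_type_exp_neg:
  assumes N: "negative_type (N :: nat \<Rightarrow> nat \<Rightarrow> real)" and t: "0 \<le> t"
  shows "positive_type (\<lambda>i j. exp (- t * N i j))"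
proof -
  let ?K = "\<lambda>i j. t * (N i 0 + N j 0 - N i j)" and ?g = "\<lambda>i. exp (- t * N i 0)"
  have "positive_type ?K"
    using positive_type_of_negative_type[OF N, of 0] t
    by (simp add: positive_type_def quad_form_scale)
  then have "positive_type (\<lambda>i j. ?g i * ?g j * exp (?K i j))"
    using positive_type_exp[of ?K] by (simp add: positive_type_def quad_form_conjugate)
  moreover have "?g i * ?g j * exp (?K i j) = exp (- t * N i j)" for i j
    by (simp flip: exp_add add: algebra_simps)
  ultimately show ?thesis by simp
qed

text \<open>The binomial series \<open>(1 - x) powr \<alpha>\<close> has constant term 1 and only nonpositive coefficients after it.\<close>
lemma gbinomial_sign:
  fixes \<alpha> :: real
  assumes "0 < \<alpha>" "\<alpha> < 1" "1 \<le> n"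
  shows "(\<alpha> gchoose n) * (- 1) ^ n \<le> 0"
  using assms(3)
proof (induction n rule: dec_induct)
  case base
  then show ?case using assms by simp
next
  case (step m)
  have "(\<alpha> gchoose Suc m) * (- 1) ^ Suc m = (\<alpha> gchoose m) * (- 1) ^ m * ((real m - \<alpha>) / (real m + 1))"
    by (simp add: gbinomial_prod_rev field_simps)
  also have "\<dots> \<le> 0"
    using step.hyps assms by (intro mult_nonpos_nonneg[OF step.IH]) auto
  finally show ?case .
qed

text \<open>Expanding the power in its binomial series writes the kernel as a constant, which balanced
  coefficients do not see, minus a nonnegative combination of powers of \<open>K\<close>. The factor \<open>r < 1\<close> keeps
  the series convergent where \<open>K i j = 1\<close>, in particular on the diagonal.\<close>
lemma quad_form_one_minus_powr:
  fixes K :: "nat \<Rightarrow> nat \<Rightarrow> real"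
  assumes K: "positive_type K" and K1: "\<And>i j. \<bar>K i j\<bar> \<le> 1" and r: "0 \<le> r" "r < 1"
    and \<alpha>: "0 < \<alpha>" "\<alpha> < 1" and A: "finite A" and c: "sum c A = 0"
  shows "quad_form A c (\<lambda>i j. (1 - r * K i j) powr \<alpha>) \<le> 0"
proof -
  let ?a = "\<lambda>n. quad_form A c (\<lambda>i j. (\<alpha> gchoose n) * (- 1) ^ n * r ^ n * K i j ^ n)"
  have "(\<lambda>n. (\<alpha> gchoose n) * (- 1) ^ n * r ^ n * K i j ^ n) sums (1 - r * K i j) powr \<alpha>" for i j
  proof -
    have "\<bar>r * K i j\<bar> \<le> r"
      using mult_left_mono[OF K1[of i j] r(1)] r by (simp add: abs_mult)
    then have "(\<lambda>n. (\<alpha> gchoose n) * (- (r * K i j)) ^ n) sums (1 + - (r * K i j)) powr \<alpha>"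
      using r by (intro gen_binomial_real) simp
    moreover have "(- (r * K i j)) ^ n = (- 1) ^ n * r ^ n * K i j ^ n" for n
      by (metis mult_minus1 power_mult_distrib mult.assoc)
    ultimately show ?thesis by (simp add: mult.assoc)
  qed
  then have sums: "?a sums quad_form A c (\<lambda>i j. (1 - r * K i j) powr \<alpha>)"
    by (intro quad_form_sums)
  have "?a n \<le> 0" for n
  proof (cases "n = 0")
    case True
    have "quad_form A c (\<lambda>i j. 1) = 0"
      using quad_form_product[of A c "\<lambda>_. 1" "\<lambda>_. 1"] c by simp
    then show ?thesis using True by simp
  next
    case False
    have "?a n = ((\<alpha> gchoose n) * (- 1) ^ n) * (r ^ n * quad_form A c (\<lambda>i j. K i j ^ n))"
      by (simp add: quad_form_scale mult.assoc)
    moreover have "0 \<le> r ^ n * quad_form A c (\<lambda>i j. K i j ^ n)"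
      using positive_type_power[OF K, of n] r A by (simp add: positive_type_def)
    ultimately show ?thesis
      using gbinomial_sign[OF \<alpha>, of n] False by (simp add: mult_nonpos_nonneg)
  qed
  then show ?thesis
    using sums_le[OF _ sums sums_zero] by blast
qed

text \<open>Fractional powers of squared Hilbert distances are again squared Hilbert distances. By Schoenberg
  \<open>exp (- N / n)\<close> has positive type, so the previous lemma applies to \<open>(1 - r n * exp (- N / n)) powr \<alpha>\<close>; after
  multiplication by \<open>n powr \<alpha>\<close> these kernels converge to \<open>N powr \<alpha>\<close>.\<close>
lemma negative_type_powr:
  assumes N: "negative_type (N :: nat \<Rightarrow> nat \<Rightarrow> real)" and \<alpha>: "0 < \<alpha>" "\<alpha> < 1"
  shows "negative_type (\<lambda>i j. N i j powr \<alpha>)"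
  unfolding negative_type_def
proof (intro conjI allI impI)
  show "N i i powr \<alpha> = 0" "N i j powr \<alpha> = N j i powr \<alpha>" for i j
    by (simp_all add: negative_type_diag[OF N] negative_type_sym[OF N, of i j])
  fix A :: "nat set" and c :: "nat \<Rightarrow> real" assume A: "finite A" and c: "sum c A = 0"
  \<comment> \<open>The defect \<open>1 - r n\<close> must be of smaller order than \<open>1 / n\<close> for the limit to be \<open>N i j\<close>.\<close>
  define r where "r n = 1 - 1 / (real n)\<^sup>2" for n
  let ?K = "\<lambda>n i j. exp (- (1 / real n) * N i j)"
  let ?M = "\<lambda>n i j. real n powr \<alpha> * (1 - r n * ?K n i j) powr \<alpha>"
  have r: "0 \<le> r n" "r n < 1" if "1 \<le> n" for n
    using that by (simp_all add: r_def)
  have K1: "\<bar>?K n i j\<bar> \<le> 1" for n i j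
    using negative_type_nonneg[OF N, of i j] by simp
  have "quad_form A c (?M n) \<le> 0" if n: "1 \<le> n" for n
    using quad_form_one_minus_powr[OF positive_type_exp_neg[OF N, of "1 / real n"] K1 r[OF n] \<alpha> A c] n
    by (simp add: quad_form_scale mult_nonneg_nonpos)
  then have ev: "\<forall>\<^sub>F n in sequentially. quad_form A c (?M n) \<le> 0"
    by (auto simp: eventually_sequentially)
  have lim: "(\<lambda>n. ?M n i j) \<longlonglongrightarrow> N i j powr \<alpha>" for i j
  proof -
    define x where "x = N i j"
    have x: "0 \<le> x" by (simp add: x_def negative_type_nonneg[OF N])
    have nonneg: "0 \<le> 1 - r n * exp (- (1 / real n) * x)" if "1 \<le> n" for n
    proof -
      have "r n * exp (- (1 / real n) * x) \<le> 1 * 1"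
        using r[OF that] x by (intro mult_mono) auto
      then show ?thesis by simp
    qed
    have "(\<lambda>n. real n * (1 - r n * exp (- (1 / real n) * x))) \<longlonglongrightarrow> x"
      unfolding r_def by real_asymp
    then have "(\<lambda>n. (real n * (1 - r n * exp (- (1 / real n) * x))) powr \<alpha>) \<longlonglongrightarrow> x powr \<alpha>"
      using nonneg \<alpha> by (intro tendsto_powr') (auto simp: eventually_sequentially intro!: exI[of _ 1])
    then show ?thesis
      unfolding x_def[symmetric]
      by (rule Lim_transform_eventually)
        (use nonneg in \<open>auto simp: eventually_sequentially powr_mult intro!: exI[of _ 1]\<close>)
  qed
  show "quad_form A c (\<lambda>i j. N i j powr \<alpha>) \<le> 0"
    using tendsto_upperbound[OF quad_form_tendsto[OF lim] ev] by simp
qed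

text \<open>Schoenberg's embedding theorem for sequences of points. The positive type kernel based at the point 0
  is twice the Gram kernel, hence the rescaling by \<open>sqrt 2\<close>.\<close>
lemma negative_type_isometric_ell2:
  assumes N: "negative_type (N :: nat \<Rightarrow> nat \<Rightarrow> real)"
  obtains F :: "nat \<Rightarrow> nat \<Rightarrow> real"
  where "\<And>i. F i \<in> ell 2" and "\<And>i j. ell_dist 2 (F i) (F j) = sqrt (N i j)"
proof -
  obtain \<phi> where fin: "\<And>i n. i < n \<Longrightarrow> \<phi> i n = 0"
    and \<phi>: "\<And>i j m. i < m \<Longrightarrow> N i 0 + N j 0 - N i j = (\<Sum>n<m. \<phi> i n * \<phi> j n)"
    using positive_type_gram[OF positive_type_of_negative_type[OF N, of 0]] by metis
  define F where "F i n = \<phi> i n / sqrt 2" for i n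
  have sums: "(\<lambda>n. \<bar>F i n - F j n\<bar> powr 2) sums N i j" for i j
  proof -
    define m where "m = Suc (max i j)"
    then have im: "i < m" and jm: "j < m" by auto
    have "(\<lambda>n. \<bar>F i n - F j n\<bar> powr 2) sums (\<Sum>n<m. \<bar>F i n - F j n\<bar> powr 2)"
      by (rule sums_finite) (auto simp: F_def fin m_def)
    also have "(\<Sum>n<m. \<bar>F i n - F j n\<bar> powr 2) =
      (\<Sum>n<m. \<phi> i n * \<phi> i n / 2 + \<phi> j n * \<phi> j n / 2 - \<phi> i n * \<phi> j n)"
    proof (rule sum.cong)
      fix n
      have "\<bar>F i n - F j n\<bar> powr 2 = (F i n - F j n)\<^sup>2" by simp
      also have "\<dots> = ((\<phi> i n - \<phi> j n) / sqrt 2)\<^sup>2"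
        by (simp add: F_def diff_divide_distrib)
      also have "\<dots> = \<phi> i n * \<phi> i n / 2 + \<phi> j n * \<phi> j n / 2 - \<phi> i n * \<phi> j n"
        by (simp add: power_divide power2_eq_square field_simps)
      finally show "\<bar>F i n - F j n\<bar> powr 2 = \<phi> i n * \<phi> i n / 2 + \<phi> j n * \<phi> j n / 2 - \<phi> i n * \<phi> j n" .
    qed simp
    also have "\<dots> = (\<Sum>n<m. \<phi> i n * \<phi> i n) / 2 + (\<Sum>n<m. \<phi> j n * \<phi> j n) / 2 - (\<Sum>n<m. \<phi> i n * \<phi> j n)"
      by (simp add: sum.distrib sum_subtractf sum_divide_distrib)
    also have "\<dots> = N i j"
      using \<phi>[OF im, of i] \<phi>[OF jm, of j] \<phi>[OF im, of j] by (simp add: negative_type_diag[OF N])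
    finally show ?thesis .
  qed
  show ?thesis
  proof
    show "F i \<in> ell 2" for i
    proof -
      have "(\<lambda>n. \<bar>F i n\<bar> powr 2) sums (\<Sum>n<Suc i. \<bar>F i n\<bar> powr 2)"
        by (rule sums_finite) (auto simp: F_def fin)
      then show ?thesis by (auto simp: ell_def sums_iff)
    qed
    show "ell_dist 2 (F i) (F j) = sqrt (N i j)" for i j
      using sums[of i j] negative_type_nonneg[OF N, of i j]
      by (simp add: ell_dist_def ell_norm_def sums_iff powr_half_sqrt)
  qed
qed

section \<open>Coarse embeddings of a dense sequence\<close>
text \<open>Wherever \<open>u\<close> is bounded, so is \<open>v\<close>. A map is a coarse embedding precisely when the distance of the source
  and the pulled back distance of the target control each other; in this form the condition is
  transitive and needs no explicit control functions.\<close>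
definition controls :: "'i set \<Rightarrow> ('i \<Rightarrow> 'i \<Rightarrow> real) \<Rightarrow> ('i \<Rightarrow> 'i \<Rightarrow> real) \<Rightarrow> bool" where
  "controls I u v \<longleftrightarrow> (\<forall>R. \<exists>S. \<forall>i\<in>I. \<forall>j\<in>I. u i j \<le> R \<longrightarrow> v i j \<le> S)"

lemma controlsI:
  assumes "\<And>i j R. i \<in> I \<Longrightarrow> j \<in> I \<Longrightarrow> u i j \<le> R \<Longrightarrow> v i j \<le> g R"
  shows "controls I u v"
  using assms unfolding controls_def by blast

lemma controls_trans: "controls I u v \<Longrightarrow> controls I v w \<Longrightarrow> controls I u w"
  unfolding controls_def by meson

lemma controls_reindex:
  assumes "controls J u v" "h ` I \<subseteq> J"
  shows "controls I (\<lambda>i j. u (h i) (h j)) (\<lambda>i j. v (h i) (h j))"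
  unfolding controls_def
proof
  fix R
  obtain S where "\<And>i j. i \<in> J \<Longrightarrow> j \<in> J \<Longrightarrow> u i j \<le> R \<Longrightarrow> v i j \<le> S"
    using assms(1) unfolding controls_def by blast
  then show "\<exists>S. \<forall>i\<in>I. \<forall>j\<in>I. u (h i) (h j) \<le> R \<longrightarrow> v (h i) (h j) \<le> S"
    using assms(2) by blast
qed

lemma coarse_embedding_controls:
  assumes d: "\<And>x y. 0 \<le> d x y" and f: "coarse_embedding M d N e f"
  shows "controls M d (\<lambda>x y. e (f x) (f y))" and "controls M (\<lambda>x y. e (f x) (f y)) d"
proof -
  from f obtain \<rho>1 \<rho>2 :: "real \<Rightarrow> real"
    where \<rho>2: "mono_on {0..} \<rho>2" and lim: "filterlim \<rho>1 at_top at_top"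
      and "\<forall>x\<in>M. \<forall>y\<in>M. \<rho>1 (d x y) \<le> e (f x) (f y) \<and> e (f x) (f y) \<le> \<rho>2 (d x y)"
    unfolding coarse_embedding_def by blast
  then have le: "\<rho>1 (d x y) \<le> e (f x) (f y) \<and> e (f x) (f y) \<le> \<rho>2 (d x y)"
    if "x \<in> M" "y \<in> M" for x y
    using that by blast
  show "controls M d (\<lambda>x y. e (f x) (f y))"
  proof (rule controlsI)
    fix x y R assume "x \<in> M" "y \<in> M" "d x y \<le> R"
    then show "e (f x) (f y) \<le> \<rho>2 R"
      using le[of x y] monotone_onD[OF \<rho>2, of "d x y" R] d[of x y] by auto
  qed
  show "controls M (\<lambda>x y. e (f x) (f y)) d"
    unfolding controls_def
  proof
    fix R
    have "\<forall>\<^sub>F t in at_top. R < \<rho>1 t"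
      using lim by (simp add: filterlim_at_top_dense)
    then obtain T where T: "\<And>t. T \<le> t \<Longrightarrow> R < \<rho>1 t"
      by (auto simp: eventually_at_top_linorder)
    have "d x y \<le> T" if "x \<in> M" "y \<in> M" "e (f x) (f y) \<le> R" for x y
      using le[OF that(1,2)] T[of "d x y"] that(3) by linarith
    then show "\<exists>S. \<forall>x\<in>M. \<forall>y\<in>M. e (f x) (f y) \<le> R \<longrightarrow> d x y \<le> S" by blast
  qed
qed

text \<open>The optimal control functions are the supremum of \<open>e (f x) (f y)\<close> over pairs at distance at most \<open>t\<close> and
  its infimum over pairs at distance at least \<open>t\<close>. Adjoining 0 and \<open>t\<close> respectively gives sensible values
  where there are no such pairs; in particular \<open>t\<close> itself keeps the lower function divergent on bounded
  spaces.\<close>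
lemma coarse_embedding_if_controls:
  assumes e: "\<And>x y. 0 \<le> e x y" and f: "f ` M \<subseteq> N"
    and upper: "controls M d (\<lambda>x y. e (f x) (f y))"
    and lower: "controls M (\<lambda>x y. e (f x) (f y)) d"
  shows "coarse_embedding M d N e f"
proof -
  define near where "near t = insert 0 {e (f x) (f y) | x y. x \<in> M \<and> y \<in> M \<and> d x y \<le> t}" for t :: real
  define far where "far t = insert t {e (f x) (f y) | x y. x \<in> M \<and> y \<in> M \<and> t \<le> d x y}" for t :: real
  have near_bdd: "bdd_above (near t)" for t
  proof -
    obtain S where "\<And>x y. x \<in> M \<Longrightarrow> y \<in> M \<Longrightarrow> d x y \<le> t \<Longrightarrow> e (f x) (f y) \<le> S"
      using upper unfolding controls_def by blast
    then show ?thesis unfolding bdd_above_def near_def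
      by (intro exI[of _ "max 0 S"]) (auto simp: max.coboundedI2)
  qed
  have far_bdd: "bdd_below (far t)" for t
    unfolding bdd_below_def far_def using e by (intro exI[of _ "min 0 t"]) (auto simp: min.coboundedI1)
  have "mono_on {0..} (\<lambda>t. Sup (near t))"
  proof (rule mono_onI)
    fix s t :: real assume "s \<le> t"
    then have "near s \<subseteq> near t" unfolding near_def by fastforce
    then show "Sup (near s) \<le> Sup (near t)"
      by (intro cSup_subset_mono near_bdd) (simp add: near_def)
  qed
  moreover have "0 \<le> Sup (near t)" for t
    by (rule cSup_upper[OF _ near_bdd]) (simp add: near_def)
  moreover have far_mono: "Inf (far s) \<le> Inf (far t)" if "s \<le> t" for s t
  proof (rule cInf_greatest)
    fix a assume a: "a \<in> far t"
    show "Inf (far s) \<le> a"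
    proof (cases "a = t")
      case True
      then show ?thesis using that cInf_lower[OF _ far_bdd, of s s] by (simp add: far_def)
    next
      case False
      then obtain x y where xy: "a = e (f x) (f y)" "x \<in> M" "y \<in> M" "t \<le> d x y"
        using a unfolding far_def by blast
      then have "s \<le> d x y" using that by simp
      then have "a \<in> far s" using xy unfolding far_def by blast
      then show ?thesis by (rule cInf_lower[OF _ far_bdd])
    qed
  qed (simp add: far_def)
  then have "mono_on {0..} (\<lambda>t. Inf (far t))"
    by (intro mono_onI) blast
  moreover have "0 \<le> Inf (far t)" if "0 \<le> t" for t
    by (rule cInf_greatest) (use that e in \<open>auto simp: far_def\<close>)
  moreover have "Inf (far (d x y)) \<le> e (f x) (f y)" "e (f x) (f y) \<le> Sup (near (d x y))"
    if "x \<in> M" "y \<in> M" for x y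
    by (rule cInf_lower[OF _ far_bdd], use that in \<open>auto simp: far_def\<close>)
      (rule cSup_upper[OF _ near_bdd], use that in \<open>auto simp: near_def\<close>)
  moreover have "filterlim (\<lambda>t. Inf (far t)) at_top at_top"
    unfolding filterlim_at_top
  proof
    fix Z :: real
    obtain S where S: "\<And>x y. x \<in> M \<Longrightarrow> y \<in> M \<Longrightarrow> e (f x) (f y) \<le> Z \<Longrightarrow> d x y \<le> S"
      using lower unfolding controls_def by blast
    have "Z \<le> Inf (far t)" if "max Z (S + 1) \<le> t" for t
    proof (rule cInf_greatest)
      fix a assume "a \<in> far t"
      then show "Z \<le> a"
        using that S unfolding far_def by fastforce
    qed (simp add: far_def)
    then show "\<forall>\<^sub>F t in at_top. Z \<le> Inf (far t)"
      unfolding eventually_at_top_linorder by blast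
  qed
  ultimately show ?thesis
    unfolding coarse_embedding_def using f
    by (intro conjI exI[of _ "\<lambda>t. Inf (far t)"] exI[of _ "\<lambda>t. Sup (near t)"]) auto
qed

lemma separable_metric_dense_sequence:
  assumes "Metric_space M d" and sep: "separable_space (Metric_space.mtopology M d)" and "M \<noteq> {}"
  obtains z :: "nat \<Rightarrow> 'a" where "range z \<subseteq> M" and "\<And>x r. x \<in> M \<Longrightarrow> 0 < r \<Longrightarrow> \<exists>n. d x (z n) < r"
proof -
  interpret Metric_space M d by fact
  obtain C where C: "countable C" "C \<subseteq> M" "mtopology closure_of C = M"
    using sep unfolding separable_space_def by auto
  then have "C \<noteq> {}" using \<open>M \<noteq> {}\<close> by auto
  show ?thesis
  proof
    show "range (from_nat_into C) \<subseteq> M"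
      using C(2) \<open>C \<noteq> {}\<close> by (auto intro: from_nat_into)
    fix x r assume "x \<in> M" "0 < (r :: real)"
    then obtain y where "y \<in> C" "d x y < r"
      using C(3) unfolding metric_closure_of by fastforce
    then show "\<exists>n. d x (from_nat_into C n) < r"
      using from_nat_into_surj[OF C(1)] by metis
  qed
qed

text \<open>Coarse embeddability only depends on a countable subset: moving each point by less than 1 to a member of
  a dense sequence changes distances by at most 2. Hence a target may be replaced by another one as
  soon as every sequence of points in the first can be redrawn in the second with mutually controlling
  distances. This is the only use of separability, and it allows all kernels to be indexed by integers.\<close>
lemma coarsely_embeds_transfer:
  fixes N :: "'b set" and N' :: "'c set"
  assumes M: "Metric_space M d" and sep: "separable_space (Metric_space.mtopology M d)"
    and emb: "coarsely_embeds M d N e" and e': "\<And>x y. 0 \<le> e' x y"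
    and transfer: "\<And>y. range y \<subseteq> N \<Longrightarrow> \<exists>F :: nat \<Rightarrow> 'c. range F \<subseteq> N' \<and>
          controls UNIV (\<lambda>i j. e (y i) (y j)) (\<lambda>i j. e' (F i) (F j)) \<and>
          controls UNIV (\<lambda>i j. e' (F i) (F j)) (\<lambda>i j. e (y i) (y j))"
  shows "coarsely_embeds M d N' e'"
proof (cases "M = {}")
  case True
  then have "coarse_embedding M d N' e' undefined"
    by (intro coarse_embedding_if_controls e') (auto simp: controls_def)
  then show ?thesis unfolding coarsely_embeds_def by blast
next
  case False
  interpret Metric_space M d by fact
  obtain z :: "nat \<Rightarrow> 'a" where z: "range z \<subseteq> M" and dense: "\<And>x r. x \<in> M \<Longrightarrow> 0 < r \<Longrightarrow> \<exists>n. d x (z n) < r"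
    using separable_metric_dense_sequence[OF M sep False] by blast
  obtain f where f: "coarse_embedding M d N e f"
    using emb unfolding coarsely_embeds_def by blast
  then have "range (f \<circ> z) \<subseteq> N"
    using z unfolding coarse_embedding_def by auto
  from transfer[OF this] obtain F :: "nat \<Rightarrow> 'c" where F: "range F \<subseteq> N'"
    and eF: "controls UNIV (\<lambda>i j. e (f (z i)) (f (z j))) (\<lambda>i j. e' (F i) (F j))"
    and Fe: "controls UNIV (\<lambda>i j. e' (F i) (F j)) (\<lambda>i j. e (f (z i)) (f (z j)))"
    by auto
  note f_controls = coarse_embedding_controls[OF nonneg f, THEN controls_reindex, OF z]
  have zF: "controls UNIV (\<lambda>i j. d (z i) (z j)) (\<lambda>i j. e' (F i) (F j))"
    by (rule controls_trans[OF f_controls(1) eF])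
  have Fz: "controls UNIV (\<lambda>i j. e' (F i) (F j)) (\<lambda>i j. d (z i) (z j))"
    by (rule controls_trans[OF Fe f_controls(2)])
  define h where "h x = (SOME n. d x (z n) < 1)" for x
  have h: "d x (z (h x)) < 1" if "x \<in> M" for x
    unfolding h_def by (rule someI_ex) (rule dense[OF that zero_less_one])
  have zM: "z n \<in> M" for n using z by auto
  have close: "\<bar>d (z (h x)) (z (h y)) - d x y\<bar> \<le> 2" if "x \<in> M" "y \<in> M" for x y
    using h[OF that(1)] h[OF that(2)]
      triangle[OF zM that(1) zM, of "h x" "h y"] triangle[OF that zM, of "h y"]
      triangle[OF that(1) zM that(2), of "h x"] triangle[OF zM zM that(2), of "h x" "h y"]
      commute[of x "z (h x)"] commute[of y "z (h y)"]
    by (auto simp: abs_le_iff)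
  have "coarse_embedding M d N' e' (F \<circ> h)"
  proof (rule coarse_embedding_if_controls[OF e'])
    show "(F \<circ> h) ` M \<subseteq> N'" using F by auto
    have "controls M d (\<lambda>x y. d (z (h x)) (z (h y)))"
      by (rule controlsI[where g = "\<lambda>R. R + 2"]) (use close in fastforce)
    from controls_trans[OF this controls_reindex[OF zF, of h]]
    show "controls M d (\<lambda>x y. e' ((F \<circ> h) x) ((F \<circ> h) y))" by simp
    have "controls M (\<lambda>x y. d (z (h x)) (z (h y))) d"
      by (rule controlsI[where g = "\<lambda>R. R + 2"]) (use close in fastforce)
    from controls_trans[OF controls_reindex[OF Fz, of h] this]
    show "controls M (\<lambda>x y. e' ((F \<circ> h) x) ((F \<circ> h) y)) d" by simp
  qed
  then show ?thesis unfolding coarsely_embeds_def by blast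
qed

lemma controls_powr:
  assumes nonneg: "\<And>i j. 0 \<le> u i j" and a: "0 < a"
  shows "controls I u (\<lambda>i j. u i j powr a)" and "controls I (\<lambda>i j. u i j powr a) u"
proof -
  show "controls I u (\<lambda>i j. u i j powr a)"
    by (rule controlsI[where g = "\<lambda>R. R powr a"]) (use nonneg a in \<open>auto intro: powr_mono2\<close>)
  show "controls I (\<lambda>i j. u i j powr a) u"
  proof (rule controlsI)
    fix i j R assume "u i j powr a \<le> R"
    then have "(u i j powr a) powr (1 / a) \<le> R powr (1 / a)"
      using a by (intro powr_mono2) auto
    then show "u i j \<le> R powr (1 / a)"
      using nonneg[of i j] a by (simp add: powr_powr)
  qed
qed

section \<open>Powers of the \<open>\<ell>\<^sub>2\<close> and \<open>L\<^sub>p\<close> distances have negative type\<close>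
lemma quad_form_square_nonpos:
  fixes a :: "'i \<Rightarrow> real"
  assumes c: "sum c A = 0"
  shows "quad_form A c (\<lambda>i j. (a i - a j)\<^sup>2) \<le> 0"
proof -
  have "(\<lambda>i j. (a i - a j)\<^sup>2) = (\<lambda>i j. (a i)\<^sup>2 * 1 + 1 * (a j)\<^sup>2 - 2 * (a i * a j))"
    by (intro ext) (simp add: power2_diff)
  then have "quad_form A c (\<lambda>i j. (a i - a j)\<^sup>2) = - 2 * (\<Sum>i\<in>A. c i * a i)\<^sup>2"
    using c
    by (simp only: quad_form_add quad_form_diff quad_form_scale[of A c 2]
        quad_form_product[of A c "\<lambda>i. (a i)\<^sup>2" "\<lambda>_. 1"] quad_form_product[of A c "\<lambda>_. 1" "\<lambda>i. (a i)\<^sup>2"]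
        quad_form_product[of A c a a]) (simp add: power2_eq_square)
  then show ?thesis by simp
qed

lemma negative_type_square: "negative_type (\<lambda>i j. ((a i :: real) - a j)\<^sup>2)"
  unfolding negative_type_def using quad_form_square_nonpos by (auto simp: power2_commute)

text \<open>On the real line \<open>\<bar>a - b\<bar> powr p\<close> is the power \<open>p / 2 < 1\<close> of the squared distance.\<close>
lemma negative_type_abs_powr:
  fixes a :: "nat \<Rightarrow> real"
  assumes "0 < p" "p < 2"
  shows "negative_type (\<lambda>i j. \<bar>a i - a j\<bar> powr p)"
proof -
  have "((x :: real)\<^sup>2) powr (p / 2) = \<bar>x\<bar> powr p" for x
  proof -
    have "(x\<^sup>2) powr (p / 2) = (\<bar>x\<bar> powr 2) powr (p / 2)" by simp
    also have "\<dots> = \<bar>x\<bar> powr p" by (simp add: powr_powr del: powr_numeral)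
    finally show ?thesis .
  qed
  then show ?thesis
    using negative_type_powr[OF negative_type_square[of a], of "p / 2"] assms by simp
qed

lemma abs_diff_powr_le:
  fixes a b p :: real
  assumes "0 \<le> p"
  shows "\<bar>a - b\<bar> powr p \<le> 2 powr p * (\<bar>a\<bar> powr p + \<bar>b\<bar> powr p)"
proof -
  have "\<bar>a - b\<bar> powr p \<le> (2 * max \<bar>a\<bar> \<bar>b\<bar>) powr p"
    using assms by (intro powr_mono2) auto
  also have "\<dots> = 2 powr p * max \<bar>a\<bar> \<bar>b\<bar> powr p"
    by (simp add: powr_mult)
  also have "\<dots> \<le> 2 powr p * (\<bar>a\<bar> powr p + \<bar>b\<bar> powr p)"
    by (intro mult_left_mono) (auto simp: max_def)
  finally show ?thesis .
qed

lemma ell_diff: 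
  assumes "x \<in> ell p" "y \<in> ell p" "0 \<le> p"
  shows "(\<lambda>i. x i - y i) \<in> ell p"
proof -
  have "summable (\<lambda>i. 2 powr p * (\<bar>x i\<bar> powr p + \<bar>y i\<bar> powr p))"
    using assms by (intro summable_mult summable_add) (auto simp: ell_def)
  then show ?thesis
    unfolding ell_def mem_Collect_eq
    by (rule summable_comparison_test') (use abs_diff_powr_le[OF assms(3)] in auto)
qed

lemma ell_dist_powr:
  assumes "x \<in> ell p" "y \<in> ell p" "0 < p"
  shows "(\<lambda>i. \<bar>x i - y i\<bar> powr p) sums (ell_dist p x y powr p)"
proof -
  have "summable (\<lambda>i. \<bar>x i - y i\<bar> powr p)"
    using ell_diff[OF assms(1,2)] assms(3) by (simp add: ell_def)
  then show ?thesis
    using assms(3) by (simp add: ell_dist_def ell_norm_def powr_powr summable_sums suminf_nonneg)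
qed

lemma negative_type_ell2:
  fixes y :: "'i \<Rightarrow> nat \<Rightarrow> real"
  assumes y: "\<And>i. y i \<in> ell 2"
  shows "negative_type (\<lambda>i j. (ell_dist 2 (y i) (y j))\<^sup>2)"
  unfolding negative_type_def
proof (intro conjI allI impI)
  have sums: "(\<lambda>n. (y i n - y j n)\<^sup>2) sums (ell_dist 2 (y i) (y j))\<^sup>2" for i j
    using ell_dist_powr[OF y y, of i j] by (simp add: ell_dist_def ell_norm_def)
  show "(ell_dist 2 (y i) (y i))\<^sup>2 = 0" for i
    by (simp add: ell_dist_def ell_norm_def)
  show "(ell_dist 2 (y i) (y j))\<^sup>2 = (ell_dist 2 (y j) (y i))\<^sup>2" for i j
    by (simp add: ell_dist_def ell_norm_def abs_minus_commute)
  fix A :: "'i set" and c :: "'i \<Rightarrow> real" assume c: "sum c A = 0"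
  have "(\<lambda>n. quad_form A c (\<lambda>i j. (y i n - y j n)\<^sup>2)) sums
      quad_form A c (\<lambda>i j. (ell_dist 2 (y i) (y j))\<^sup>2)"
    by (rule quad_form_sums) (rule sums)
  then show "quad_form A c (\<lambda>i j. (ell_dist 2 (y i) (y j))\<^sup>2) \<le> 0"
    by (rule sums_le[OF quad_form_square_nonpos[OF c] _ sums_zero])
qed

lemma Lp_seminorm_powr:
  assumes "0 < p"
  shows "Lp_seminorm p f powr p = (LINT t|lebesgue_on {0..1}. \<bar>f t\<bar> powr p)"
  using assms by (simp add: Lp_seminorm_def powr_powr)

text \<open>Negative type is a family of linear inequalities, so it passes from the real line to \<open>L\<^sub>p\<close> by integrating
  the pointwise inequality.\<close>
lemma negative_type_Lp_fun:
  fixes f :: "nat \<Rightarrow> real \<Rightarrow> real"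
  assumes f: "\<And>i. f i \<in> Lp_fun p" and p: "0 < p" "p < 2"
  shows "negative_type (\<lambda>i j. LINT t|lebesgue_on {0..1}. \<bar>f i t - f j t\<bar> powr p)"
proof -
  let ?L = "lebesgue_on {0..1 :: real}"
  have int: "integrable ?L (\<lambda>t. \<bar>f i t - f j t\<bar> powr p)" for i j
  proof (rule Bochner_Integration.integrable_bound)
    show "integrable ?L (\<lambda>t. 2 powr p * (\<bar>f i t\<bar> powr p + \<bar>f j t\<bar> powr p))"
      using f by (auto simp: Lp_fun_def)
    have "f i \<in> borel_measurable ?L" "f j \<in> borel_measurable ?L"
      using f by (auto simp: Lp_fun_def)
    then show "(\<lambda>t. \<bar>f i t - f j t\<bar> powr p) \<in> borel_measurable ?L" by measurable
    show "AE t in ?L. norm (\<bar>f i t - f j t\<bar> powr p) \<le> norm (2 powr p * (\<bar>f i t\<bar> powr p + \<bar>f j t\<bar> powr p))"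
      using p by (intro AE_I2) (simp add: abs_diff_powr_le)
  qed
  show ?thesis
    unfolding negative_type_def
  proof (intro conjI allI impI)
    show "(LINT t|?L. \<bar>f i t - f i t\<bar> powr p) = 0" for i by simp
    show "(LINT t|?L. \<bar>f i t - f j t\<bar> powr p) = (LINT t|?L. \<bar>f j t - f i t\<bar> powr p)" for i j
      by (simp add: abs_minus_commute)
    fix A :: "nat set" and c :: "nat \<Rightarrow> real" assume A: "finite A" "sum c A = 0"
    have "quad_form A c (\<lambda>i j. LINT t|?L. \<bar>f i t - f j t\<bar> powr p) =
        (LINT t|?L. quad_form A c (\<lambda>i j. \<bar>f i t - f j t\<bar> powr p))"
      unfolding quad_form_def using int by (simp add: Bochner_Integration.integral_sum)
    also have "\<dots> \<le> (LINT t|?L. 0)"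
      using negative_type_abs_powr[OF p] A int
      by (intro integral_mono) (auto simp: negative_type_def quad_form_def)
    finally show "quad_form A c (\<lambda>i j. LINT t|?L. \<bar>f i t - f j t\<bar> powr p) \<le> 0" by simp
  qed
qed

lemma Lp_representative:
  assumes "A \<in> Lp p" obtains f where "f \<in> Lp_fun p" "A = Lp_rel p `` {f}"
  using assms unfolding Lp_def quotient_def by blast

lemma negative_type_Lp:
  fixes y :: "nat \<Rightarrow> (real \<Rightarrow> real) set"
  assumes y: "\<And>i. y i \<in> Lp p" and p: "0 < p" "p < 2"
  shows "negative_type (\<lambda>i j. Lp_dist p (y i) (y j) powr p)"
proof -
  have "\<forall>i. \<exists>f. f \<in> Lp_fun p \<and> y i = Lp_rel p `` {f}"
    using Lp_representative[OF y] by metis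
  then obtain f where f: "\<And>i. f i \<in> Lp_fun p" and "\<And>i. y i = Lp_rel p `` {f i}"
    by metis
  then show ?thesis
    using negative_type_Lp_fun[OF f p] by (simp add: Lp_dist_class Lp_seminorm_powr p)
qed

section \<open>The Mazur map\<close>
text \<open>Applied to each coordinate with \<open>s = 2 / p\<close>, this is the Mazur map between the unit spheres of \<open>\<ell>\<^sub>2\<close> and
  \<open>\<ell>\<^sub>p\<close>.\<close>
definition signed_powr :: "real \<Rightarrow> real \<Rightarrow> real" where
  "signed_powr s x = sgn x * \<bar>x\<bar> powr s"

lemma signed_powr_nonneg: "0 \<le> x \<Longrightarrow> signed_powr s x = x powr s"
  by (cases "x = 0") (auto simp: signed_powr_def)

lemma signed_powr_minus: "signed_powr s (- x) = - signed_powr s x"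
  by (simp add: signed_powr_def sgn_minus)

text \<open>For a symmetric comparison of two values of an odd function it suffices to treat two nonnegative
  arguments in a given order and two arguments of opposite sign.\<close>
lemma odd_comparison_cases:
  fixes a b :: real
  assumes same: "\<And>a b. 0 \<le> b \<Longrightarrow> b \<le> a \<Longrightarrow> P a b"
    and opposite: "\<And>a b. 0 \<le> a \<Longrightarrow> 0 \<le> b \<Longrightarrow> P a (- b)"
    and sym: "\<And>a b. P a b \<Longrightarrow> P b a" and odd: "\<And>a b. P a b \<Longrightarrow> P (- a) (- b)"
  shows "P a b"
proof -
  have nn: "P x y" if "0 \<le> x" "0 \<le> y" for x y
    using same[of x y] same[of y x] sym[of y x] that by linarith
  consider "0 \<le> a" "0 \<le> b" | "0 \<le> a" "b \<le> 0" | "a \<le> 0" "0 \<le> b" | "a \<le> 0" "b \<le> 0"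
    by linarith
  then show ?thesis
  proof cases
    case 1
    then show ?thesis by (rule nn)
  next
    case 2
    then show ?thesis using opposite[of a "- b"] by simp
  next
    case 3
    then show ?thesis using sym[OF opposite[of b "- a"]] by simp
  next
    case 4
    then show ?thesis using odd[OF nn[of "- a" "- b"]] by simp
  qed
qed

lemma powr_eq_mult_powr_minus_1: "0 \<le> (x :: real) \<Longrightarrow> x powr s = x * x powr (s - 1)"
  by (cases "x = 0") (auto simp: powr_diff)

lemma powr_add_le:
  fixes x y s :: real
  assumes "0 \<le> x" "0 \<le> y" "1 \<le> s"
  shows "x powr s + y powr s \<le> (x + y) powr s"
proof -
  have "x powr s + y powr s = x * x powr (s - 1) + y * y powr (s - 1)"
    using assms powr_eq_mult_powr_minus_1 by metis
  also have "\<dots> \<le> x * (x + y) powr (s - 1) + y * (x + y) powr (s - 1)"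
    using assms by (intro add_mono mult_left_mono powr_mono2) auto
  also have "\<dots> = (x + y) * (x + y) powr (s - 1)"
    by (simp add: distrib_right)
  also have "\<dots> = (x + y) powr s"
    using assms powr_eq_mult_powr_minus_1[of "x + y" s] by simp
  finally show ?thesis .
qed

text \<open>A mean value estimate. Since \<open>s - 1 \<le> 1\<close> and \<open>b / a \<le> 1\<close>, the bound \<open>b / a \<le> (b / a) powr (s - 1)\<close> reduces it to the
  factorization of \<open>a\<^sup>2 - b\<^sup>2\<close>.\<close>
lemma powr_diff_le:
  fixes a b s :: real
  assumes "0 \<le> b" "b \<le> a" "1 \<le> s" "s \<le> 2"
  shows "a powr s - b powr s \<le> 2 * (a - b) * a powr (s - 1)"
proof (cases "b = 0")
  case True
  have "0 \<le> a * a powr (s - 1)" using assms by simp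
  then show ?thesis using True assms powr_eq_mult_powr_minus_1[of a s] by simp
next
  case False
  then have pos: "0 < b" "0 < a" using assms by auto
  have "b / a \<le> (b / a) powr (s - 1)"
    using powr_mono'[of "s - 1" 1 "b / a"] pos assms by simp
  then have "b / a * a powr (s - 1) \<le> b powr (s - 1)"
    using pos by (simp add: powr_divide field_simps)
  then have "b * (b / a * a powr (s - 1)) \<le> b * b powr (s - 1)"
    using pos by (intro mult_left_mono) auto
  then have "a powr s - b powr s \<le> a * a powr (s - 1) - b * (b / a * a powr (s - 1))"
    using pos powr_eq_mult_powr_minus_1[of a s] powr_eq_mult_powr_minus_1[of b s] by simp
  also have "\<dots> = (a - b) * (1 + b / a) * a powr (s - 1)"
    using pos by (simp add: field_simps)
  also have "\<dots> \<le> (a - b) * 2 * a powr (s - 1)"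
    using pos assms by (intro mult_right_mono mult_left_mono) auto
  finally show ?thesis by (simp add: mult_ac)
qed

lemma signed_powr_diff_le:
  assumes "1 \<le> s" "s \<le> 2"
  shows "\<bar>signed_powr s a - signed_powr s b\<bar> \<le> 2 * \<bar>a - b\<bar> * (\<bar>a\<bar> + \<bar>b\<bar>) powr (s - 1)"
proof (induction a b rule: odd_comparison_cases)
  case (1 a b)
  have "\<bar>signed_powr s a - signed_powr s b\<bar> = a powr s - b powr s"
    using 1 assms by (simp add: signed_powr_nonneg powr_mono2)
  also have "\<dots> \<le> 2 * (a - b) * a powr (s - 1)"
    using 1 assms by (intro powr_diff_le) auto
  also have "\<dots> \<le> 2 * (a - b) * (a + b) powr (s - 1)"
    using 1 assms by (intro mult_left_mono powr_mono2) auto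
  finally show ?case using 1 by simp
next
  case (2 a b)
  have "\<bar>signed_powr s a - signed_powr s (- b)\<bar> = a powr s + b powr s"
    using 2 by (simp add: signed_powr_minus signed_powr_nonneg)
  also have "\<dots> \<le> (a + b) powr s"
    using 2 assms by (intro powr_add_le) auto
  also have "\<dots> = (a + b) * (a + b) powr (s - 1)"
    using 2 by (intro powr_eq_mult_powr_minus_1) auto
  also have "\<dots> \<le> 2 * ((a + b) * (a + b) powr (s - 1))"
    using 2 by simp
  also have "\<dots> = 2 * \<bar>a - (- b)\<bar> * (\<bar>a\<bar> + \<bar>- b\<bar>) powr (s - 1)"
    using 2 by simp
  finally show ?case .
qed (simp_all add: signed_powr_minus abs_minus_commute add.commute)

lemma powr_half_diff_le_signed_powr:
  assumes "1 \<le> s"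
  shows "(\<bar>a - b\<bar> / 2) powr s \<le> \<bar>signed_powr s a - signed_powr s b\<bar>"
proof (induction a b rule: odd_comparison_cases)
  case (1 a b)
  have "((a - b) / 2) powr s \<le> (a - b) powr s"
    using 1 assms by (intro powr_mono2) auto
  also have "\<dots> \<le> a powr s - b powr s"
    using powr_add_le[of "a - b" b s] 1 assms by simp
  finally show ?case using 1 by (simp add: signed_powr_nonneg)
next
  case (2 a b)
  have "((a + b) / 2) powr s \<le> max a b powr s"
    using 2 assms by (intro powr_mono2) auto
  also have "\<dots> \<le> a powr s + b powr s"
    by (auto simp: max_def)
  finally show ?case using 2 by (simp add: signed_powr_minus signed_powr_nonneg)
qed (simp_all add: signed_powr_minus abs_minus_commute add.commute)

text \<open>A weighted form of Young's inequality with free parameter \<open>\<epsilon>\<close>, which takes the place of Hoelder's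
  inequality with exponents \<open>2 / p\<close> and \<open>2 / (2 - p)\<close> in the continuity of the Mazur map. It is proved by
  comparing \<open>x\<close> with \<open>\<epsilon> * m\<close>.\<close>
lemma young_powr:
  fixes x m \<epsilon> p :: real
  assumes "0 \<le> x" "0 \<le> m" "0 < \<epsilon>" "\<epsilon> \<le> 1" "1 \<le> p" "p < 2"
  shows "x powr p * m powr (2 - p) \<le> \<epsilon> * m\<^sup>2 + x\<^sup>2 / \<epsilon>"
proof (cases "x \<le> \<epsilon> * m")
  case True
  have "x powr p * m powr (2 - p) \<le> (\<epsilon> * m) powr p * m powr (2 - p)"
    using assms True by (intro mult_right_mono powr_mono2) auto
  also have "\<dots> = \<epsilon> powr p * (m powr p * m powr (2 - p))"
    by (simp add: powr_mult)
  also have "m powr p * m powr (2 - p) = m\<^sup>2"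
    using assms by (cases "m = 0") (simp_all flip: powr_add)
  also have "\<epsilon> powr p * m\<^sup>2 \<le> \<epsilon> * m\<^sup>2"
    using assms by (intro mult_right_mono powr_le_one_le) auto
  also have "\<dots> \<le> \<epsilon> * m\<^sup>2 + x\<^sup>2 / \<epsilon>"
    using assms by simp
  finally show ?thesis .
next
  case False
  then have x: "0 < x" and m: "m \<le> x / \<epsilon>"
    using assms by (auto simp: field_simps not_le intro: le_less_trans[OF mult_nonneg_nonneg, of \<epsilon> m])
  have "x powr p * m powr (2 - p) \<le> x powr p * (x / \<epsilon>) powr (2 - p)"
    using assms m by (intro mult_left_mono powr_mono2) auto
  also have "\<dots> = x powr p * x powr (2 - p) / \<epsilon> powr (2 - p)"
    using x assms by (simp add: powr_divide)
  also have "x powr p * x powr (2 - p) = x\<^sup>2"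
    using x by (simp flip: powr_add)
  also have "x\<^sup>2 / \<epsilon> powr (2 - p) \<le> x\<^sup>2 / \<epsilon>"
    using powr_mono'[of "2 - p" 1 \<epsilon>] assms by (intro divide_left_mono) auto
  also have "\<dots> \<le> \<epsilon> * m\<^sup>2 + x\<^sup>2 / \<epsilon>"
    using assms by simp
  finally show ?thesis .
qed

text \<open>Continuity of the Mazur map in one coordinate: summed over the coordinates of two unit vectors at
  squared distance \<open>D\<close>, the right-hand side is \<open>16 * \<epsilon> + 4 * D / \<epsilon>\<close>, which is small for small \<open>D\<close> and suitable \<open>\<epsilon>\<close>.\<close>
lemma mazur_upper:
  assumes p: "1 \<le> p" "p < 2" and \<epsilon>: "0 < \<epsilon>" "\<epsilon> \<le> 1"
  shows "\<bar>signed_powr (2 / p) a - signed_powr (2 / p) b\<bar> powr p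
         \<le> 8 * \<epsilon> * (a\<^sup>2 + b\<^sup>2) + 4 / \<epsilon> * (a - b)\<^sup>2"
proof -
  define x m where "x = \<bar>a - b\<bar>" and "m = \<bar>a\<bar> + \<bar>b\<bar>"
  have "\<bar>signed_powr (2 / p) a - signed_powr (2 / p) b\<bar> powr p \<le> (2 * x * m powr (2 / p - 1)) powr p"
    unfolding x_def m_def using p by (intro powr_mono2 signed_powr_diff_le) (auto simp: field_simps)
  also have "\<dots> = 2 powr p * (x powr p * m powr (2 - p))"
    using p by (simp add: powr_mult powr_powr x_def m_def left_diff_distrib)
  also have "\<dots> \<le> 2 powr 2 * (x powr p * m powr (2 - p))"
    using p by (intro mult_right_mono powr_mono) auto
  also have "\<dots> \<le> 4 * (\<epsilon> * m\<^sup>2 + x\<^sup>2 / \<epsilon>)"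
    using young_powr[of x m \<epsilon> p] p \<epsilon> by (simp add: x_def m_def)
  also have "\<dots> \<le> 4 * (\<epsilon> * (2 * (a\<^sup>2 + b\<^sup>2)) + x\<^sup>2 / \<epsilon>)"
  proof -
    have "m\<^sup>2 \<le> 2 * (a\<^sup>2 + b\<^sup>2)"
      using sum_squares_bound[of "\<bar>a\<bar>" "\<bar>b\<bar>"] by (simp add: m_def power2_sum)
    then show ?thesis using \<epsilon> by (intro mult_left_mono add_right_mono) auto
  qed
  also have "\<dots> = 8 * \<epsilon> * (a\<^sup>2 + b\<^sup>2) + 4 / \<epsilon> * (a - b)\<^sup>2"
    by (simp add: x_def algebra_simps)
  finally show ?thesis .
qed

text \<open>The inverse of the Mazur map is Hoelder continuous with exponent \<open>p / 2\<close>, again in one coordinate.\<close>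
lemma mazur_lower:
  assumes p: "1 \<le> p" "p < 2"
  shows "(a - b)\<^sup>2 / 4 \<le> \<bar>signed_powr (2 / p) a - signed_powr (2 / p) b\<bar> powr p"
proof -
  have "(a - b)\<^sup>2 / 4 = (\<bar>a - b\<bar> / 2) powr 2"
    by (simp add: power_divide)
  also have "\<dots> = ((\<bar>a - b\<bar> / 2) powr (2 / p)) powr p"
    using p by (simp add: powr_powr del: powr_numeral)
  also have "\<dots> \<le> \<bar>signed_powr (2 / p) a - signed_powr (2 / p) b\<bar> powr p"
    using p by (intro powr_mono2 powr_half_diff_le_signed_powr) auto
  finally show ?thesis .
qed

section \<open>From negative type kernels to \<open>\<ell>\<^sub>p\<close>\<close>
text \<open>A Gaussian kernel is the Gram kernel of unit vectors \<open>\<xi> i\<close> in \<open>\<ell>\<^sub>2\<close> with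
  squared distances \<open>2 * (1 - exp (- t * N i j))\<close>; the vectors \<open>\<eta> i\<close> are their images under the Mazur map. Pairs
  with \<open>1 + N i j\<close> small compared with \<open>1 / sqrt t\<close> are sent close together, pairs with \<open>N i j\<close> at least
  \<open>1 / t\<close> stay a fixed distance apart.\<close>
lemma gaussian_sphere_map:
  fixes N :: "nat \<Rightarrow> nat \<Rightarrow> real"
  assumes N: "negative_type N" and t: "0 < t" "t \<le> 1" and p: "1 \<le> p" "p < 2"
  obtains \<eta> :: "nat \<Rightarrow> nat \<Rightarrow> real" where "\<And>i n. i < n \<Longrightarrow> \<eta> i n = 0"
    and "\<And>i j m. i < m \<Longrightarrow> j < m \<Longrightarrow>
      (1 - exp (- t * N i j)) / 2 \<le> (\<Sum>n<m. \<bar>\<eta> i n - \<eta> j n\<bar> powr p)"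
    and "\<And>i j m. i < m \<Longrightarrow> j < m \<Longrightarrow>
      (\<Sum>n<m. \<bar>\<eta> i n - \<eta> j n\<bar> powr p) \<le> 16 * sqrt t * (1 + N i j)"
proof -
  have gauss: "positive_type (\<lambda>i j. exp (- t * N i j))"
    using t by (intro positive_type_exp_neg[OF N]) auto
  obtain \<xi> where fin: "\<And>i n. i < n \<Longrightarrow> \<xi> i n = 0"
    and \<xi>: "\<And>i j m. i < m \<Longrightarrow> exp (- t * N i j) = (\<Sum>n<m. \<xi> i n * \<xi> j n)"
    by (rule positive_type_gram[OF gauss]) (rule that, assumption+)
  have norm: "(\<Sum>n<m. (\<xi> i n)\<^sup>2) = 1" if "i < m" for i m
    using \<xi>[OF that, of i] by (simp add: negative_type_diag[OF N] power2_eq_square)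
  have dist: "(\<Sum>n<m. (\<xi> i n - \<xi> j n)\<^sup>2) = 2 * (1 - exp (- t * N i j))" if "i < m" "j < m" for i j m
  proof -
    have "(\<Sum>n<m. (\<xi> i n - \<xi> j n)\<^sup>2) =
      (\<Sum>n<m. (\<xi> i n)\<^sup>2) + (\<Sum>n<m. (\<xi> j n)\<^sup>2) - 2 * (\<Sum>n<m. \<xi> i n * \<xi> j n)"
      by (simp add: power2_diff sum.distrib sum_subtractf sum_distrib_left mult.assoc)
    then show ?thesis using that norm \<xi>[OF that(1), of j] by simp
  qed
  define \<eta> where "\<eta> i n = signed_powr (2 / p) (\<xi> i n)" for i n
  show ?thesis
  proof
    show "\<eta> i n = 0" if "i < n" for i n
      using fin[OF that] by (simp add: \<eta>_def signed_powr_def)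
    fix i j m :: nat assume m: "i < m" "j < m"
    have "(1 - exp (- t * N i j)) / 2 = (\<Sum>n<m. (\<xi> i n - \<xi> j n)\<^sup>2 / 4)"
      using dist[OF m] by (simp flip: sum_divide_distrib)
    also have "\<dots> \<le> (\<Sum>n<m. \<bar>\<eta> i n - \<eta> j n\<bar> powr p)"
      unfolding \<eta>_def by (intro sum_mono mazur_lower p)
    finally show "(1 - exp (- t * N i j)) / 2 \<le> (\<Sum>n<m. \<bar>\<eta> i n - \<eta> j n\<bar> powr p)" .
    \<comment> \<open>The choice \<open>\<epsilon> = sqrt t\<close> balances the two terms, as the squared distance is at most \<open>2 * t * N i j\<close>.\<close>
    have "(\<Sum>n<m. \<bar>\<eta> i n - \<eta> j n\<bar> powr p) \<le>
        (\<Sum>n<m. 8 * sqrt t * ((\<xi> i n)\<^sup>2 + (\<xi> j n)\<^sup>2) + 4 / sqrt t * (\<xi> i n - \<xi> j n)\<^sup>2)"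
      unfolding \<eta>_def using t by (intro sum_mono mazur_upper p) auto
    also have "\<dots> = 8 * sqrt t * ((\<Sum>n<m. (\<xi> i n)\<^sup>2) + (\<Sum>n<m. (\<xi> j n)\<^sup>2)) +
        4 / sqrt t * (\<Sum>n<m. (\<xi> i n - \<xi> j n)\<^sup>2)"
      by (simp only: sum.distrib flip: sum_distrib_left)
    also have "\<dots> = 16 * sqrt t + 8 / sqrt t * (1 - exp (- t * N i j))"
      using norm m by (simp add: dist)
    also have "\<dots> \<le> 16 * sqrt t + 8 / sqrt t * (t * N i j)"
      using exp_ge_add_one_self[of "- t * N i j"] t by (intro add_left_mono mult_left_mono) auto
    also have "8 / sqrt t * (t * N i j) = 8 * (t / sqrt t) * N i j"
      by simp
    also have "t / sqrt t = sqrt t"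
      using t by (simp add: real_div_sqrt)
    also have "16 * sqrt t + 8 * sqrt t * N i j \<le> 16 * sqrt t * (1 + N i j)"
      using negative_type_nonneg[OF N, of i j] t by (simp add: algebra_simps)
    finally show "(\<Sum>n<m. \<bar>\<eta> i n - \<eta> j n\<bar> powr p) \<le> 16 * sqrt t * (1 + N i j)" .
  qed
qed

lemma sums_prod_decode:
  fixes h :: "nat \<Rightarrow> nat \<Rightarrow> real"
  assumes nonneg: "\<And>k n. 0 \<le> h k n" and row: "\<And>k. h k sums G k" and G: "summable G"
  shows "(\<lambda>m. h (fst (prod_decode m)) (snd (prod_decode m))) sums suminf G"
proof -
  let ?f = "\<lambda>(k, n). h k n"
  have "0 \<le> G k" for k
    using sums_le[OF _ sums_zero row[of k]] nonneg by blast
  then have Gs: "(G has_sum suminf G) UNIV"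
    using G by (intro sums_nonneg_imp_has_sum summable_sums)
  have rows: "((\<lambda>n. ?f (k, n)) has_sum G k) UNIV" for k
    using sums_nonneg_imp_has_sum[OF row[of k]] nonneg by simp
  have "?f summable_on UNIV \<times> UNIV"
    using rows Gs nonneg by (intro summable_on_SigmaI) (auto simp: summable_on_def)
  then have "(?f has_sum suminf G) (UNIV \<times> UNIV)"
    using rows Gs by (intro has_sum_SigmaI) auto
  then have "((\<lambda>m. ?f (prod_decode m)) has_sum suminf G) UNIV"
    using bij_prod_decode by (subst has_sum_reindex_bij_betw) simp_all
  then show ?thesis
    using has_sum_imp_sums by (simp add: case_prod_beta)
qed

text \<open>The Gaussian maps at the scales \<open>t = (1 / 4) ^ k\<close> are put side by side in one \<open>\<ell>\<^sub>p\<close>, after translating each by its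
  value at 0 to make the combined sequence summable. The upper bounds form a geometric series with
  sum \<open>32 * (1 + N i j)\<close>. For the lower bound, each scale with \<open>(1 / 4) ^ k * N i j \<ge> 1\<close> contributes at least
  \<open>1 / 4\<close>, and the number of these scales grows without bound with \<open>N i j\<close>.\<close>
lemma negative_type_coarse_ell_p:
  fixes N :: "nat \<Rightarrow> nat \<Rightarrow> real"
  assumes N: "negative_type N" and p: "1 \<le> p" "p < 2"
  obtains F :: "nat \<Rightarrow> nat \<Rightarrow> real" where "\<And>i. F i \<in> ell p"
    and "controls UNIV N (\<lambda>i j. ell_dist p (F i) (F j))"
    and "controls UNIV (\<lambda>i j. ell_dist p (F i) (F j)) N"
proof -
  define good :: "nat \<Rightarrow> (nat \<Rightarrow> nat \<Rightarrow> real) \<Rightarrow> bool" where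
    "good k \<eta> \<longleftrightarrow> (\<forall>i n. i < n \<longrightarrow> \<eta> i n = 0) \<and> (\<forall>i j m. i < m \<longrightarrow> j < m \<longrightarrow>
      (1 - exp (- ((1 / 4) ^ k) * N i j)) / 2 \<le> (\<Sum>n<m. \<bar>\<eta> i n - \<eta> j n\<bar> powr p) \<and>
      (\<Sum>n<m. \<bar>\<eta> i n - \<eta> j n\<bar> powr p) \<le> 16 * sqrt ((1 / 4) ^ k) * (1 + N i j))" for k \<eta>
  have "\<exists>\<eta>. good k \<eta>" for k
    unfolding good_def
    by (rule gaussian_sphere_map[OF N _ _ p, of "(1 / 4) ^ k"]) (simp, simp add: power_le_one, blast)
  then obtain \<eta> where good: "\<And>k. good k (\<eta> k)"
    by metis
  have fin: "\<eta> k i n = 0" if "i < n" for k i n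
    using good[of k] that unfolding good_def by blast
  have lower: "(1 - exp (- ((1 / 4) ^ k) * N i j)) / 2 \<le> (\<Sum>n<m. \<bar>\<eta> k i n - \<eta> k j n\<bar> powr p)"
    and upper: "(\<Sum>n<m. \<bar>\<eta> k i n - \<eta> k j n\<bar> powr p) \<le> 16 * sqrt ((1 / 4) ^ k) * (1 + N i j)"
    if "i < m" "j < m" for k i j m
    using good[of k] that unfolding good_def by blast+
  define G where "G i j k = (\<Sum>n<Suc (max i j). \<bar>\<eta> k i n - \<eta> k j n\<bar> powr p)" for i j k
  have row: "(\<lambda>n. \<bar>\<eta> k i n - \<eta> k j n\<bar> powr p) sums G i j k" for i j k
    unfolding G_def by (rule sums_finite) (auto simp: fin)
  have G_lower: "(1 - exp (- ((1 / 4) ^ k) * N i j)) / 2 \<le> G i j k" for i j k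
    unfolding G_def by (rule lower) auto
  have G_upper: "G i j k \<le> 16 * (1 + N i j) * (1 / 2) ^ k" for i j k
  proof -
    have "G i j k \<le> 16 * sqrt ((1 / 4) ^ k) * (1 + N i j)"
      unfolding G_def by (rule upper) auto
    moreover have "sqrt ((1 / 4) ^ k) = (1 / 2) ^ k"
      by (simp add: real_sqrt_power real_sqrt_divide)
    ultimately show ?thesis by (simp only: mult_ac)
  qed
  have G_nonneg: "0 \<le> G i j k" for i j k
    unfolding G_def by (rule sum_nonneg) simp
  have geometric: "(\<lambda>k. 16 * (1 + N i j) * (1 / 2) ^ k) sums (32 * (1 + N i j))" for i j
    using sums_mult[OF geometric_sums[of "1 / 2 :: real"], of "16 * (1 + N i j)"] by simp
  have G_summable: "summable (G i j)" for i j
    by (rule summable_comparison_test'[OF sums_summable[OF geometric[of i j]]])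
      (use G_upper G_nonneg in auto)
  define F where "F i m = (let (k, n) = prod_decode m in \<eta> k i n - \<eta> k 0 n)" for i m
  have F_sums: "(\<lambda>m. \<bar>F i m - F j m\<bar> powr p) sums suminf (G i j)" for i j
  proof -
    have "\<bar>F i m - F j m\<bar> powr p =
        (\<lambda>k n. \<bar>\<eta> k i n - \<eta> k j n\<bar> powr p) (fst (prod_decode m)) (snd (prod_decode m))" for m
      by (simp add: F_def case_prod_beta)
    then show ?thesis
      using sums_prod_decode[OF _ row G_summable] by simp
  qed
  have F0: "F 0 m = 0" for m
    by (simp add: F_def case_prod_beta)
  have F_ell: "F i \<in> ell p" for i
    using F_sums[of i 0] by (simp add: ell_def F0 sums_iff)
  have dist: "ell_dist p (F i) (F j) = suminf (G i j) powr (1 / p)" for i j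
    using F_sums[of i j] by (simp add: ell_dist_def ell_norm_def sums_iff)
  have G_sum_nonneg: "0 \<le> suminf (G i j)" for i j
    by (rule suminf_nonneg[OF G_summable G_nonneg])
  have G_controlled: "controls UNIV N (\<lambda>i j. suminf (G i j))"
  proof (rule controlsI)
    fix i j R assume "N i j \<le> R"
    have "suminf (G i j) \<le> 32 * (1 + N i j)"
      by (rule sums_le[OF G_upper summable_sums[OF G_summable] geometric])
    then show "suminf (G i j) \<le> 32 * (1 + R)" using \<open>N i j \<le> R\<close> by simp
  qed
  have G_controls: "controls UNIV (\<lambda>i j. suminf (G i j)) N"
    unfolding controls_def
  proof
    fix R :: real
    obtain K :: nat where K: "4 * R < real K"
      using reals_Archimedean2 by blast
    have "N i j \<le> 4 ^ K" if R: "suminf (G i j) \<le> R" for i j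
    proof (rule ccontr)
      assume N_large: "\<not> N i j \<le> 4 ^ K"
      have "1 / 4 \<le> G i j k" if k: "k < K" for k
      proof -
        have "1 \<le> (1 / 4) ^ k * (4 :: real) ^ K"
          using k by (simp add: power_one_over)
        also have "\<dots> \<le> (1 / 4) ^ k * N i j"
          using N_large by (intro mult_left_mono) auto
        finally have "exp (- ((1 / 4) ^ k) * N i j) \<le> exp (- 1)" by simp
        also have "\<dots> \<le> (1 / 2 :: real)"
          using exp_ge_add_one_self[of 1] by (simp add: exp_minus field_simps)
        finally show ?thesis using G_lower[of k i j] by simp
      qed
      then have "(\<Sum>k<K. 1 / 4) \<le> (\<Sum>k<K. G i j k)"
        by (intro sum_mono) simp
      also have "\<dots> \<le> suminf (G i j)"
        using G_summable G_nonneg by (intro sum_le_suminf) auto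
      finally show False using R K by simp
    qed
    then show "\<exists>S. \<forall>i\<in>UNIV. \<forall>j\<in>UNIV. suminf (G i j) \<le> R \<longrightarrow> N i j \<le> S" by blast
  qed
  have "0 < 1 / p" using p by simp
  note root = controls_powr[of "\<lambda>i j. suminf (G i j)", OF G_sum_nonneg this]
  show ?thesis
  proof (rule that[of F])
    show "controls UNIV N (\<lambda>i j. ell_dist p (F i) (F j))"
      unfolding dist by (rule controls_trans[OF G_controlled root(1)])
    show "controls UNIV (\<lambda>i j. ell_dist p (F i) (F j)) N"
      unfolding dist by (rule controls_trans[OF root(2) G_controls])
  qed (rule F_ell)
qed

section \<open>\<open>\<ell>\<^sub>p\<close> inside \<open>L\<^sub>p\<close>\<close>
text \<open>On \<open>{0<..1}\<close> the value is \<open>n\<close> exactly when \<open>1 / (n + 2) < t \<le> 1 / (n + 1)\<close>; the value at 0 is arbitrary. The level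
  sets partition the interval into countably many cells of positive measure.\<close>
definition reciprocal_index :: "real \<Rightarrow> nat" where
  "reciprocal_index t = nat \<lfloor>1 / t\<rfloor> - 1"

definition cell_measure :: "nat \<Rightarrow> real" where
  "cell_measure n = measure (lebesgue_on {0..1}) (reciprocal_index -` {n} \<inter> {0..1})"

lemma finite_measure_unit_interval: "finite_measure (lebesgue_on {0..1 :: real})"
  by (rule finite_measure_lebesgue_on) simp

lemma reciprocal_index_measurable: "reciprocal_index \<in> measurable (lebesgue_on {0..1}) (count_space UNIV)"
proof -
  have "reciprocal_index \<in> measurable lborel (count_space UNIV)"
    unfolding reciprocal_index_def[abs_def] by measurable
  then have "reciprocal_index \<in> measurable lebesgue (count_space UNIV)"
    by (rule measurable_completion)
  then show ?thesis by (rule measurable_restrict_space1)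
qed

lemma cell_sets: "reciprocal_index -` {n} \<inter> {0..1} \<in> sets (lebesgue_on {0..1})"
  using measurable_sets[OF reciprocal_index_measurable, of "{n}"] by simp

lemma cell_measure_pos: "0 < cell_measure n"
proof -
  let ?L = "lebesgue_on {0..1 :: real}"
  interpret finite_measure ?L by (rule finite_measure_unit_interval)
  let ?I = "{1 / (real n + 2)<..<1 / (real n + 1)}"
  have sub: "?I \<subseteq> {0..1}"
  proof
    fix t assume t: "t \<in> ?I"
    have "1 / (real n + 1) \<le> 1" "0 \<le> 1 / (real n + 2)" by simp_all
    then show "t \<in> {0..1}"
      using t unfolding atLeastAtMost_iff greaterThanLessThan_iff by linarith
  qed
  have "?I \<subseteq> reciprocal_index -` {n}"
  proof
    fix t assume t: "t \<in> ?I"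
    moreover have "0 < 1 / (real n + 2)" by simp
    ultimately have "0 < t" by (metis greaterThanLessThan_iff less_trans)
    then have "\<lfloor>1 / t\<rfloor> = int n + 1"
      using t by (intro floor_unique) (auto simp: field_simps)
    then show "t \<in> reciprocal_index -` {n}" by (simp add: reciprocal_index_def nat_add_distrib)
  qed
  then have "measure ?L ?I \<le> cell_measure n"
    unfolding cell_measure_def using sub by (intro finite_measure_mono cell_sets) auto
  moreover have "measure ?L ?I = 1 / (real n + 1) - 1 / (real n + 2)"
    using sub by (simp add: measure_restrict_space frac_le)
  moreover have "1 / (real n + 2) < 1 / (real n + 1)" by (simp add: frac_less2)
  ultimately show ?thesis by simp
qed

lemma has_bochner_integral_cells:
  assumes nonneg: "\<And>n. 0 \<le> g n" and sums: "(\<lambda>n. g n * cell_measure n) sums S"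
  shows "has_bochner_integral (lebesgue_on {0..1}) (\<lambda>t. g (reciprocal_index t)) S"
proof (rule has_bochner_integral_nn_integral)
  let ?L = "lebesgue_on {0..1 :: real}"
  interpret finite_measure ?L by (rule finite_measure_unit_interval)
  let ?C = "\<lambda>n. reciprocal_index -` {n} \<inter> {0..1}"
  note [measurable] = reciprocal_index_measurable
  show "(\<lambda>t. g (reciprocal_index t)) \<in> borel_measurable ?L" by measurable
  show "AE t in ?L. 0 \<le> g (reciprocal_index t)" using nonneg by simp
  have terms: "0 \<le> g n * cell_measure n" for n
    using nonneg cell_measure_pos[of n] by simp
  then show S: "0 \<le> S"
    using sums_le[OF _ sums_zero sums] by blast
  have "(\<integral>\<^sup>+ t. ennreal (g (reciprocal_index t)) \<partial>?L) = (\<integral>\<^sup>+ t. (\<Sum>n. ennreal (g n) * indicator (?C n) t) \<partial>?L)"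
  proof (rule nn_integral_cong)
    fix t assume "t \<in> space ?L"
    then have "(\<Sum>n. ennreal (g n) * indicator (?C n) t) =
        (\<Sum>n. if n = reciprocal_index t then ennreal (g n) else 0)"
      by (intro suminf_cong) (auto simp: indicator_def)
    also have "\<dots> = ennreal (g (reciprocal_index t))"
      by (subst suminf_finite[of "{reciprocal_index t}"]) auto
    finally show "ennreal (g (reciprocal_index t)) = (\<Sum>n. ennreal (g n) * indicator (?C n) t)" by simp
  qed
  also have "\<dots> = (\<Sum>n. \<integral>\<^sup>+ t. ennreal (g n) * indicator (?C n) t \<partial>?L)"
    by (intro nn_integral_suminf borel_measurable_times_ennreal borel_measurable_const
        borel_measurable_indicator cell_sets)
  also have "\<dots> = (\<Sum>n. ennreal (g n * cell_measure n))"
    using nonneg cell_sets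
    by (intro suminf_cong)
      (simp add: nn_integral_cmult_indicator emeasure_eq_measure ennreal_mult' cell_measure_def)
  also have "\<dots> = ennreal S"
    using terms sums by (rule suminf_ennreal_eq)
  finally show "(\<integral>\<^sup>+ t. ennreal (g (reciprocal_index t)) \<partial>?L) = ennreal S" .
qed

text \<open>The value on a cell is scaled so that the cell contributes exactly \<open>\<bar>x n\<bar> powr p\<close> to the integral of the
  \<open>p\<close>-th power.\<close>
definition step_function :: "real \<Rightarrow> (nat \<Rightarrow> real) \<Rightarrow> real \<Rightarrow> real" where
  "step_function p x t = x (reciprocal_index t) * cell_measure (reciprocal_index t) powr (- 1 / p)"

lemma step_function_integral:
  assumes "x \<in> ell p" "0 < p"
  shows "has_bochner_integral (lebesgue_on {0..1}) (\<lambda>t. \<bar>step_function p x t\<bar> powr p) (\<Sum>n. \<bar>x n\<bar> powr p)"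
proof -
  let ?g = "\<lambda>n. \<bar>x n * cell_measure n powr (- 1 / p)\<bar> powr p"
  have "?g n * cell_measure n = \<bar>x n\<bar> powr p" for n
    using cell_measure_pos[of n] assms(2)
    by (simp add: abs_mult powr_mult powr_powr powr_minus powr_divide field_simps)
  then have "(\<lambda>n. ?g n * cell_measure n) sums (\<Sum>n. \<bar>x n\<bar> powr p)"
    using assms(1) by (simp add: ell_def summable_sums)
  from has_bochner_integral_cells[OF _ this] show ?thesis
    by (simp add: step_function_def)
qed

lemma step_function_Lp_fun:
  assumes "x \<in> ell p" "0 < p"
  shows "step_function p x \<in> Lp_fun p"
proof -
  note [measurable] = reciprocal_index_measurable
  have "step_function p x \<in> borel_measurable (lebesgue_on {0..1})"
    unfolding step_function_def[abs_def] by measurable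
  then show ?thesis
    using step_function_integral[OF assms] by (auto simp: Lp_fun_def has_bochner_integral_iff)
qed

lemma ell_p_isometric_Lp:
  assumes p: "0 < p" and x: "x \<in> ell p" and y: "y \<in> ell p"
  shows "Lp_dist p (Lp_rel p `` {step_function p x}) (Lp_rel p `` {step_function p y}) = ell_dist p x y"
proof -
  have "step_function p x t - step_function p y t = step_function p (\<lambda>n. x n - y n) t" for t
    by (simp add: step_function_def left_diff_distrib)
  then show ?thesis
    using step_function_integral[OF ell_diff[OF x y] p] p
    by (simp add: Lp_dist_class[OF step_function_Lp_fun[OF x p] step_function_Lp_fun[OF y p]]
        Lp_seminorm_def ell_dist_def ell_norm_def has_bochner_integral_iff)
qed

section \<open>The equivalence\<close>
lemma ell_dist_nonneg: "0 \<le> ell_dist p x y"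
  by (simp add: ell_dist_def ell_norm_def)

lemma Lp_dist_nonneg: "0 \<le> Lp_dist p A B"
  by (simp add: Lp_dist_def Lp_seminorm_def)

theorem theorem5:
  fixes M :: "'a set" and d :: "'a \<Rightarrow> 'a \<Rightarrow> real" and p :: real
  assumes "Metric_space M d"
    and "separable_space (Metric_space.mtopology M d)"
    and "1 \<le> p" and "p < 2"
  shows "(coarsely_embeds M d (ell 2) (ell_dist 2) \<longleftrightarrow> coarsely_embeds M d (ell p) (ell_dist p))
       \<and> (coarsely_embeds M d (ell p) (ell_dist p) \<longleftrightarrow> coarsely_embeds M d (Lp p) (Lp_dist p))"
proof -
  have p: "0 < p" "1 \<le> p" "p < 2" using assms by auto
  note transfer = coarsely_embeds_transfer[OF assms(1,2)]
  have "coarsely_embeds M d (ell p) (ell_dist p)" if "coarsely_embeds M d (ell 2) (ell_dist 2)"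
  proof (rule transfer[OF that ell_dist_nonneg])
    fix y :: "nat \<Rightarrow> nat \<Rightarrow> real" assume "range y \<subseteq> ell 2"
    then have "negative_type (\<lambda>i j. (ell_dist 2 (y i) (y j))\<^sup>2)"
      by (intro negative_type_ell2) auto
    then obtain F :: "nat \<Rightarrow> nat \<Rightarrow> real" where F: "\<And>i. F i \<in> ell p"
      "controls UNIV (\<lambda>i j. (ell_dist 2 (y i) (y j))\<^sup>2) (\<lambda>i j. ell_dist p (F i) (F j))"
      "controls UNIV (\<lambda>i j. ell_dist p (F i) (F j)) (\<lambda>i j. (ell_dist 2 (y i) (y j))\<^sup>2)"
      using negative_type_coarse_ell_p p(2,3) by blast
    have "controls UNIV (\<lambda>i j. ell_dist 2 (y i) (y j)) (\<lambda>i j. (ell_dist 2 (y i) (y j))\<^sup>2)"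
      "controls UNIV (\<lambda>i j. (ell_dist 2 (y i) (y j))\<^sup>2) (\<lambda>i j. ell_dist 2 (y i) (y j))"
      using controls_powr[of "\<lambda>i j. ell_dist 2 (y i) (y j)" 2] by (simp_all add: ell_dist_nonneg)
    then show "\<exists>F. range F \<subseteq> ell p \<and>
        controls UNIV (\<lambda>i j. ell_dist 2 (y i) (y j)) (\<lambda>i j. ell_dist p (F i) (F j)) \<and>
        controls UNIV (\<lambda>i j. ell_dist p (F i) (F j)) (\<lambda>i j. ell_dist 2 (y i) (y j))"
      using F controls_trans by (intro exI[of _ F]) blast
  qed
  moreover have "coarsely_embeds M d (Lp p) (Lp_dist p)" if "coarsely_embeds M d (ell p) (ell_dist p)"
  proof (rule transfer[OF that Lp_dist_nonneg])
    fix y :: "nat \<Rightarrow> nat \<Rightarrow> real" assume y: "range y \<subseteq> ell p"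
    define F where "F i = Lp_rel p `` {step_function p (y i)}" for i
    have "Lp_dist p (F i) (F j) = ell_dist p (y i) (y j)" for i j
      unfolding F_def using y by (intro ell_p_isometric_Lp p) auto
    moreover have "range F \<subseteq> Lp p"
      unfolding F_def Lp_def using y p by (auto intro!: quotientI step_function_Lp_fun)
    ultimately show "\<exists>F. range F \<subseteq> Lp p \<and>
        controls UNIV (\<lambda>i j. ell_dist p (y i) (y j)) (\<lambda>i j. Lp_dist p (F i) (F j)) \<and>
        controls UNIV (\<lambda>i j. Lp_dist p (F i) (F j)) (\<lambda>i j. ell_dist p (y i) (y j))"
      by (intro exI[of _ F]) (auto simp: controls_def)
  qed
  moreover have "coarsely_embeds M d (ell 2) (ell_dist 2)" if "coarsely_embeds M d (Lp p) (Lp_dist p)"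
  proof (rule transfer[OF that ell_dist_nonneg])
    fix y :: "nat \<Rightarrow> (real \<Rightarrow> real) set" assume "range y \<subseteq> Lp p"
    then have "negative_type (\<lambda>i j. Lp_dist p (y i) (y j) powr p)"
      using p by (intro negative_type_Lp) auto
    then obtain F :: "nat \<Rightarrow> nat \<Rightarrow> real" where F: "\<And>i. F i \<in> ell 2"
      and dist: "\<And>i j. ell_dist 2 (F i) (F j) = sqrt (Lp_dist p (y i) (y j) powr p)"
      using negative_type_isometric_ell2 by blast
    have "sqrt (Lp_dist p (y i) (y j) powr p) = Lp_dist p (y i) (y j) powr (p / 2)" for i j
      by (simp add: powr_powr flip: powr_half_sqrt)
    then show "\<exists>F. range F \<subseteq> ell 2 \<and>
        controls UNIV (\<lambda>i j. Lp_dist p (y i) (y j)) (\<lambda>i j. ell_dist 2 (F i) (F j)) \<and>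
        controls UNIV (\<lambda>i j. ell_dist 2 (F i) (F j)) (\<lambda>i j. Lp_dist p (y i) (y j))"
      using F controls_powr[of "\<lambda>i j. Lp_dist p (y i) (y j)" "p / 2" UNIV] p
      by (intro exI[of _ F]) (auto simp: dist Lp_dist_nonneg)
  qed
  ultimately show ?thesis by blast
qed

end
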